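(* Let $d\ge 0$ be an integer, let $V_1,\ldots,V_{d+1}$ be pairwise disjoint non-empty finite sets, put $V=V_1\sqcup\cdots\sqcup V_{d+1}$, and let $T\subseteq V_1*\cdots*V_{d+1}$ be a $\mathbb Z_2$-spanning $d$-tree (of the complex $X=V_1*\cdots*V_{d+1}$). Let $A:|\Delta_V|\to\mathbb R^d$ be an affine map such that $0\in A(V_i\cup V_j)$ for every pair $1\le i<j\le d+1$. Then there exists a face $\sigma\in T$ such that $0\in A(\sigma)$.
   Context: An abstract simplicial complex is a family of finite subsets (faces) of a ground set that is closed under taking subsets and contains $\varnothing$; the dimension of a face is its cardinality minus $1$; a facet is an inclusion-maximal face. For a finite set $V$, $\Delta_V:=2^V$ is the full simplex on $V$. $V_1*\cdots*V_{d+1}$ is the complex of all subsets of $V_1\sqcup\cdots\sqcup V_{d+1}$ containing at most one element of each $V_i$. For a complex $K$ on a finite vertex set $V$, each vertex $v$ is placed at the standard basis vector $e_v\in\mathbb R^V$; for $\sigma\in K$, $|\sigma|=\operatorname{conv}\{e_v:v\in\sigma\}$, $|\sigma|^\circ$ is its relative interior (the open simplex), and $|K|=\bigsqcup_{\sigma\in K}|\sigma|^\circ$. A map $A:|K|\to\mathbb R^d$ is affine if it is the affine extension over each face of its values on the vertices. For $\sigma\in K$ one writes $A(\sigma):=A(|\sigma|^\circ)$. In the hypothesis, $V_i\cup V_j$ is regarded as a face of $\Delta_V$, so $A(V_i\cup V_j)=A(|V_i\cup V_j|^\circ)$. Let $X$ be a finite $k$-dimensional simplicial complex. A subcomplex $T\subseteq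 X$ is a $\mathbb Z_2$-spanning $k$-tree if $T$ contains all faces of $X$ of dimension at most $k-1$ and: (1) $\widetilde H_k(T;\mathbb Z_2)=0$; (2) $\widetilde H_k(T\cup\{\sigma\};\mathbb Z_2)\neq 0$ for every facet $\sigma$ of $X$ that does not belong to $T$. Here $\widetilde H_*$ denotes reduced simplicial homology. *)

theory Defs
  imports
    "HOL-Analysis.Analysis"
    "HOL-Analysis.Finite_Function_Topology"
    "HOL-Algebra.Elementary_Groups"
    "HOL-Library.Z2"
begin

section \<open>Abstract simplicial complexes\<close>

definition simplicial_complex :: "'v set set \<Rightarrow> bool" where
  "simplicial_complex K \<longleftrightarrow>
     {} \<in> K \<and> (\<forall>\<sigma>\<in>K. finite \<sigma>) \<and> (\<forall>\<sigma>\<in>K. \<forall>\<tau>. \<tau> \<subseteq> \<sigma> \<longrightarrow> \<tau> \<in> K)"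

definition face_dim :: "'v set \<Rightarrow> int" where
  "face_dim \<sigma> = int (card \<sigma>) - 1"

definition complex_dim :: "'v set set \<Rightarrow> int" where
  "complex_dim K = Max (face_dim ` K)"

definition facet :: "'v set set \<Rightarrow> 'v set \<Rightarrow> bool" where
  "facet K \<sigma> \<longleftrightarrow> \<sigma> \<in> K \<and> (\<forall>\<tau>\<in>K. \<sigma> \<subseteq> \<tau> \<longrightarrow> \<tau> = \<sigma>)"

definition full_simplex :: "'v set \<Rightarrow> 'v set set" where
  "full_simplex V = Pow V"

text \<open>The join of the discrete complexes on the sets \<open>V i\<close>, \<open>i \<in> I\<close> (used for pairwise
  disjoint finite \<open>V i\<close>).\<close>

definition discrete_join :: "'i set \<Rightarrow> ('i \<Rightarrow> 'v set) \<Rightarrow> 'v set set" where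
  "discrete_join I V = {\<sigma>. finite \<sigma> \<and> \<sigma> \<subseteq> (\<Union>i\<in>I. V i) \<and> (\<forall>i\<in>I. card (\<sigma> \<inter> V i) \<le> 1)}"

section \<open>Reduced simplicial homology with coefficients in the field with two elements\<close>

text \<open>Chains are finitely supported functions from faces to the two-element field \<^typ>\<open>bit\<close>.
  The degree is an integer, and the empty face spans the chains of degree \<open>-1\<close>; the boundary
  map from degree 0 to degree \<open>-1\<close> is therefore the augmentation, which makes the homology
  reduced. No orientation is needed because signs are irrelevant modulo 2.\<close>

type_synonym 'v chain2 = "'v set \<Rightarrow>\<^sub>0 bit"

definition chain_group2 :: "int \<Rightarrow> 'v set set \<Rightarrow> 'v chain2 monoid" where
  "chain_group2 k K =
     \<lparr>carrier = {c. Poly_Mapping.keys c \<subseteq> {\<sigma>\<in>K. face_dim \<sigma> = k}}, monoid.mult = (+), one = 0\<rparr>"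

definition boundary2 :: "'v chain2 \<Rightarrow> 'v chain2" where
  "boundary2 c =
     (\<Sum>\<sigma>\<in>Poly_Mapping.keys c. \<Sum>v\<in>\<sigma>.
        Poly_Mapping.single (\<sigma> - {v}) (Poly_Mapping.lookup c \<sigma>))"

definition cycle_group2 :: "int \<Rightarrow> 'v set set \<Rightarrow> 'v chain2 monoid" where
  "cycle_group2 k K =
     (chain_group2 k K)
       \<lparr>carrier := kernel (chain_group2 k K) (chain_group2 (k - 1) K) boundary2\<rparr>"

definition reduced_homology2 :: "int \<Rightarrow> 'v set set \<Rightarrow> 'v chain2 set monoid" where
  "reduced_homology2 k K =
     cycle_group2 k K Mod (boundary2 ` carrier (chain_group2 (k + 1) K))"

definition Z2_spanning_tree :: "nat \<Rightarrow> 'v set set \<Rightarrow> 'v set set \<Rightarrow> bool" where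
  "Z2_spanning_tree k X T \<longleftrightarrow>
     finite X \<and> simplicial_complex X \<and> complex_dim X = int k \<and>
     simplicial_complex T \<and> T \<subseteq> X \<and>
     (\<forall>\<sigma>\<in>X. face_dim \<sigma> \<le> int k - 1 \<longrightarrow> \<sigma> \<in> T) \<and>
     trivial_group (reduced_homology2 (int k) T) \<and>
     (\<forall>\<sigma>. facet X \<sigma> \<and> \<sigma> \<notin> T \<longrightarrow> \<not> trivial_group (reduced_homology2 (int k) (T \<union> {\<sigma>})))"

section \<open>Geometric realization and affine maps\<close>

text \<open>For a finite index set \<open>J\<close>, the space of real vectors indexed by \<open>J\<close> is the subspace of
  the normed space of finitely supported functions consisting of those supported in \<open>J\<close>. Unlike
  a type of class \<^class>\<open>euclidean_space\<close>, this includes the zero-dimensional space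
  (\<open>J = {}\<close>). On each such subspace the topology is the usual one.\<close>

definition coord_space :: "'i set \<Rightarrow> ('i \<Rightarrow>\<^sub>0 real) set" where
  "coord_space J = {x. Poly_Mapping.keys x \<subseteq> J}"

abbreviation real_space :: "nat \<Rightarrow> (nat \<Rightarrow>\<^sub>0 real) set" where
  "real_space d \<equiv> coord_space {..<d}"

abbreviation basis_vec :: "'v \<Rightarrow> ('v \<Rightarrow>\<^sub>0 real)" where
  "basis_vec v \<equiv> Poly_Mapping.single v 1"

definition closed_simplex :: "'v set \<Rightarrow> ('v \<Rightarrow>\<^sub>0 real) set" where
  "closed_simplex \<sigma> = convex hull (basis_vec ` \<sigma>)"

definition open_simplex :: "'v set \<Rightarrow> ('v \<Rightarrow>\<^sub>0 real) set" where
  "open_simplex \<sigma> = rel_interior (closed_simplex \<sigma>)"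

definition realization :: "'v set set \<Rightarrow> ('v \<Rightarrow>\<^sub>0 real) set" where
  "realization K = (\<Union>\<sigma>\<in>K. open_simplex \<sigma>)"

definition affine_map_on :: "'v set set \<Rightarrow> (('v \<Rightarrow>\<^sub>0 real) \<Rightarrow> 'b::real_vector) \<Rightarrow> bool" where
  "affine_map_on K A \<longleftrightarrow>
     (\<forall>\<sigma>\<in>K. \<forall>u. (\<forall>v\<in>\<sigma>. 0 \<le> u v) \<and> sum u \<sigma> = 1 \<longrightarrow>
        A (\<Sum>v\<in>\<sigma>. u v *\<^sub>R basis_vec v) = (\<Sum>v\<in>\<sigma>. u v *\<^sub>R A (basis_vec v)))"

text \<open>The image of a face is the image of its open simplex.\<close>

definition face_image :: "(('v \<Rightarrow>\<^sub>0 real) \<Rightarrow> 'b) \<Rightarrow> 'v set \<Rightarrow> 'b set" where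
  "face_image A \<sigma> = A ` open_simplex \<sigma>"

end

theory Submission
  imports Defs
begin

text \<open>Write \<open>a v\<close> for the image of the vertex \<open>v\<close>, and say that a face captures \<open>0\<close> if \<open>0\<close> lies in the
  convex hull of the images of its vertices. Fix a vector \<open>w\<close> in general position and let \<open>f \<tau>\<close> record
  whether \<open>w\<close> lies in the cone over \<open>\<tau>\<close>. If no proper face of a \<open>d\<close>-simplex \<open>\<sigma>\<close> captures \<open>0\<close>, then
  the sum of \<open>f\<close> over the facets of \<open>\<sigma>\<close> is, modulo 2, the indicator of \<open>\<sigma>\<close> capturing \<open>0\<close>. Hence the
  number of capturing simplices in a \<open>d\<close>-chain depends only on its boundary, and it is even for a
  cycle. If a colourful simplex \<open>\<sigma>\<close> outside \<open>T\<close> captures \<open>0\<close>, the cycle in \<open>T \<union> {\<sigma>}\<close> through \<open>\<sigma>\<close>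
  therefore contains a second capturing simplex, which is in \<open>T\<close>. That some colourful simplex captures
  \<open>0\<close> is a colourful Caratheodory theorem; it follows from the same parity principle, applied to a
  cone over a cross-polytope at the point of the colourful simplices nearest to \<open>0\<close>.\<close>

section \<open>Cones, linear relations and lines through an orthant\<close>

definition in_cone :: "('v \<Rightarrow> 'b::real_vector) \<Rightarrow> 'v set \<Rightarrow> 'b \<Rightarrow> bool" where
  "in_cone a \<sigma> w \<longleftrightarrow> (\<exists>c. (\<forall>v\<in>\<sigma>. 0 \<le> c v) \<and> (\<Sum>v\<in>\<sigma>. c v *\<^sub>R a v) = w)"

text \<open>Dividing by the coefficient sum turns such a relation into a convex combination; leaving
  it unnormalised saves rescaling when relations are combined. Coefficients belong to vertices, so
  \<open>a\<close> may repeat vectors. The nonzero coefficient keeps the empty face from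
  capturing.\<close>

definition captures :: "('v \<Rightarrow> 'b::real_vector) \<Rightarrow> 'v set \<Rightarrow> bool" where
  "captures a \<sigma> \<longleftrightarrow>
     (\<exists>c. (\<forall>v\<in>\<sigma>. 0 \<le> c v) \<and> (\<exists>v\<in>\<sigma>. c v \<noteq> 0) \<and> (\<Sum>v\<in>\<sigma>. c v *\<^sub>R a v) = 0)"

lemma sum_scaleR_mono_neutral:
  fixes a :: "'v \<Rightarrow> 'b::real_vector"
  assumes "finite \<sigma>" "\<rho> \<subseteq> \<sigma>" "\<And>v. v \<in> \<sigma> - \<rho> \<Longrightarrow> c v = 0"
  shows "(\<Sum>v\<in>\<sigma>. c v *\<^sub>R a v) = (\<Sum>v\<in>\<rho>. c v *\<^sub>R a v)"
  using assms by (intro sum.mono_neutral_right) auto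

text \<open>A family may repeat a vector; then coefficients 1 and -1 on two equal members already
  form a relation, and only an injective family needs the dimension bound.\<close>

lemma family_dependent:
  fixes a :: "'i \<Rightarrow> 'b::real_vector"
  assumes "finite I" "finite B" "card B < card I" "a ` I \<subseteq> span B"
  obtains c where "\<exists>i\<in>I. c i \<noteq> 0" "(\<Sum>i\<in>I. c i *\<^sub>R a i) = 0"
proof (cases "inj_on a I")
  case True
  have "dependent (a ` I)"
    using independent_span_bound[OF assms(2) _ assms(4)] assms(3) card_image[OF True] by force
  then obtain u where u: "\<exists>v\<in>a ` I. u v \<noteq> 0" "(\<Sum>v\<in>a ` I. u v *\<^sub>R v) = 0"
    using assms(1) by (auto simp: dependent_finite)
  show ?thesis
    by (rule that[of "u \<circ> a"]) (use u True in \<open>auto simp: sum.reindex\<close>)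
next
  case False
  then obtain i j where ij: "i \<in> I" "j \<in> I" "i \<noteq> j" "a i = a j"
    by (auto simp: inj_on_def)
  let ?c = "\<lambda>k. if k = i then 1 else if k = j then - 1 else (0::real)"
  have "(\<Sum>k\<in>I. ?c k *\<^sub>R a k) = (\<Sum>k\<in>{i, j}. ?c k *\<^sub>R a k)"
    by (rule sum_scaleR_mono_neutral) (use assms ij in auto)
  then show ?thesis
    by (intro that[of ?c]) (use ij in auto)
qed

text \<open>The exchange step of Caratheodory's theorem: from the nonnegative \<open>\<mu>\<close>,
  move along \<open>\<nu>\<close> until the first coordinate reaches 0. The sign of \<open>t\<close>
  is free, so a nonzero entry of \<open>\<nu>\<close> of either sign suffices.\<close>

lemma subtract_until_zero:
  fixes \<mu> \<nu> :: "'i \<Rightarrow> real"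
  assumes "finite I" "\<And>i. i \<in> I \<Longrightarrow> 0 \<le> \<mu> i" "\<exists>i\<in>I. \<nu> i \<noteq> 0"
  obtains t where "\<And>i. i \<in> I \<Longrightarrow> 0 \<le> \<mu> i - t * \<nu> i" "\<exists>i\<in>I. \<mu> i - t * \<nu> i = 0"
proof -
  have *: "\<exists>t. (\<forall>i\<in>I. 0 \<le> \<mu> i - t * \<nu> i) \<and> (\<exists>i\<in>I. \<mu> i - t * \<nu> i = 0)"
    if j: "j \<in> I" "\<nu> j > 0" for \<nu> :: "'i \<Rightarrow> real" and j
  proof -
    define P where "P = {i\<in>I. \<nu> i > 0}"
    \<comment> \<open>The smallest ratio over the positive entries is the longest step that keeps
      all coordinates nonnegative; an index attaining it is one that becomes 0.\<close>
    define t where "t = Min ((\<lambda>i. \<mu> i / \<nu> i) ` P)"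
    have P: "finite P" "P \<noteq> {}"
      using assms(1) j by (auto simp: P_def)
    have "t \<in> (\<lambda>i. \<mu> i / \<nu> i) ` P"
      unfolding t_def using P by (intro Min_in) auto
    then obtain k where k: "k \<in> P" "t = \<mu> k / \<nu> k" by auto
    have le: "t \<le> \<mu> i / \<nu> i" if "i \<in> P" for i
      unfolding t_def using P that by (intro Min_le) auto
    have t0: "0 \<le> t" using k assms(2) by (auto simp: P_def)
    have "0 \<le> \<mu> i - t * \<nu> i" if i: "i \<in> I" for i
    proof (cases "\<nu> i > 0")
      case True
      then show ?thesis using le[of i] i by (auto simp: P_def field_simps)
    next
      case False
      then have "t * \<nu> i \<le> 0" using t0 by (simp add: mult_nonneg_nonpos)
      then show ?thesis using assms(2)[OF i] by linarith
    qed
    moreover have "\<mu> k - t * \<nu> k = 0" "k \<in> I" using k by (auto simp: P_def)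
    ultimately show ?thesis by blast
  qed
  obtain j where j: "j \<in> I" "\<nu> j \<noteq> 0" using assms(3) by blast
  show ?thesis
  proof (cases "\<nu> j > 0")
    case True
    then show ?thesis using *[of j \<nu>] j that by blast
  next
    case False
    then obtain t where "(\<forall>i\<in>I. 0 \<le> \<mu> i - t * - \<nu> i) \<and> (\<exists>i\<in>I. \<mu> i - t * - \<nu> i = 0)"
      using *[of j "\<lambda>i. - \<nu> i"] j by auto
    then show ?thesis using that[of "- t"] by auto
  qed
qed

lemma finite_arg_max:
  fixes t :: "'i \<Rightarrow> real"
  assumes "finite P" "P \<noteq> {}"
  obtains p where "p \<in> P" "\<And>u. u \<in> P \<Longrightarrow> t u \<le> t p"
proof -
  have "Max (t ` P) \<in> t ` P" using assms by (intro Max_in) auto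
  then obtain p where "p \<in> P" "t p = Max (t ` P)" by force
  then show ?thesis using that[of p] assms by auto
qed

text \<open>The points of the line \<open>l + t m\<close> lying on the boundary of the nonnegative orthant:
  the line meets the orthant in a segment or in nothing, unless \<open>m\<close> has constant sign and
  it meets it in a ray.\<close>

lemma odd_orthant_hits_pos:
  fixes l m :: "'i \<Rightarrow> real"
  assumes fin: "finite I" and "I \<noteq> {}"
    and inj: "\<And>t u v. u \<in> I \<Longrightarrow> v \<in> I \<Longrightarrow> l u + t * m u = 0 \<Longrightarrow> l v + t * m v = 0 \<Longrightarrow> u = v"
    and pos: "\<And>v. v \<in> I \<Longrightarrow> 0 < m v"
  shows "odd (card {v\<in>I. m v \<noteq> 0 \<and> (\<forall>u\<in>I. 0 \<le> l u + (- l v / m v) * m u)})"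
proof -
  define t where "t v = - l v / m v" for v
  obtain p where p: "p \<in> I" "\<And>u. u \<in> I \<Longrightarrow> t u \<le> t p"
    using finite_arg_max[of I t] assms by metis
  have le: "0 \<le> l u + t v * m u \<longleftrightarrow> t u \<le> t v" if "u \<in> I" for u v
    using pos[OF that] unfolding t_def[of u] by (auto simp: field_simps)
  have "v = p" if "v \<in> I" "t v = t p" for v
    by (rule inj[of v p "t p"]) (use that p pos[of v] pos[of p] in \<open>auto simp: t_def field_simps\<close>)
  then have "{v\<in>I. m v \<noteq> 0 \<and> (\<forall>u\<in>I. 0 \<le> l u + t v * m u)} = {p}"
    using le p pos by (auto simp: order_less_imp_not_eq2) (meson antisym)
  then show ?thesis by (simp add: t_def)
qed

text \<open>For \<open>m v \<noteq> 0\<close> the parameter \<open>- l v / m v\<close> is where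
  coordinate \<open>v\<close> vanishes, so the set counts the ends of the part of the line inside
  the orthant, each once because of \<open>inj\<close>. A segment has two ends, a ray one. The last
  two hypotheses exclude directions of weakly constant sign with a zero entry.\<close>

lemma odd_orthant_hits_iff:
  fixes l m :: "'i \<Rightarrow> real"
  assumes fin: "finite I" and ne: "I \<noteq> {}"
    and inj: "\<And>t u v. u \<in> I \<Longrightarrow> v \<in> I \<Longrightarrow> l u + t * m u = 0 \<Longrightarrow> l v + t * m v = 0 \<Longrightarrow> u = v"
    and pos: "(\<forall>v\<in>I. 0 \<le> m v) \<Longrightarrow> \<forall>v\<in>I. 0 < m v"
    and neg: "(\<forall>v\<in>I. m v \<le> 0) \<Longrightarrow> \<forall>v\<in>I. m v < 0"
  shows "odd (card {v\<in>I. m v \<noteq> 0 \<and> (\<forall>u\<in>I. 0 \<le> l u + (- l v / m v) * m u)}) \<longleftrightarrow>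
         (\<forall>v\<in>I. 0 < m v) \<or> (\<forall>v\<in>I. m v < 0)" (is "odd (card ?H) \<longleftrightarrow> _")
proof -
  define t where "t v = - l v / m v" for v
  have H: "?H = {v\<in>I. m v \<noteq> 0 \<and> (\<forall>u\<in>I. 0 \<le> l u + t v * m u)}"
    by (simp add: t_def)
  consider (p) "\<forall>v\<in>I. 0 < m v" | (n) "\<forall>v\<in>I. m v < 0" |
    (mixed) "\<not> (\<forall>v\<in>I. 0 \<le> m v)" "\<not> (\<forall>v\<in>I. m v \<le> 0)"
    using pos neg by blast
  then show ?thesis
  proof cases
    case p
    then show ?thesis using odd_orthant_hits_pos[of I l m] fin ne inj by blast
  next
    case n
    have "odd (card {v\<in>I. - m v \<noteq> 0 \<and> (\<forall>u\<in>I. 0 \<le> l u + (- l v / - m v) * - m u)})"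
    proof (rule odd_orthant_hits_pos[OF fin ne])
      show "u = v" if "u \<in> I" "v \<in> I" "l u + t * - m u = 0" "l v + t * - m v = 0" for t u v
        by (rule inj[of u v "- t"]) (use that in auto)
    qed (use n in auto)
    then show ?thesis using n by simp
  next
    case mixed
    define P where "P = {v\<in>I. 0 < m v}"
    define N where "N = {v\<in>I. m v < 0}"
    have "finite P" "finite N" "P \<noteq> {}" "N \<noteq> {}"
      using mixed fin by (auto simp: P_def N_def not_le)
    \<comment> \<open>A coordinate of positive slope bounds the parameter from below, one of
      negative slope from above; \<open>p\<close> gives the largest lower bound and \<open>n\<close>
      the smallest upper bound.\<close>
    then obtain p n where p: "p \<in> P" "\<And>u. u \<in> P \<Longrightarrow> t u \<le> t p"
      and n: "n \<in> N" "\<And>u. u \<in> N \<Longrightarrow> - t u \<le> - t n"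
      using finite_arg_max[of P t] finite_arg_max[of N "\<lambda>v. - t v"] by metis
    have leP: "0 \<le> l u + s * m u \<longleftrightarrow> t u \<le> s" if "u \<in> P" for u s
      using that unfolding t_def[of u] by (auto simp: field_simps P_def)
    have leN: "0 \<le> l u + s * m u \<longleftrightarrow> s \<le> t u" if "u \<in> N" for u s
      using that unfolding t_def[of u] by (auto simp: field_simps N_def)
    have eq: "u = v" if "u \<in> I" "v \<in> I" "m u \<noteq> 0" "m v \<noteq> 0" "t u = t v" for u v
      by (rule inj[of u v "t u"]) (use that in \<open>auto simp: t_def field_simps\<close>)
    have IPN: "v \<in> P \<or> v \<in> N \<or> m v = 0" if "v \<in> I" for v
      using that by (auto simp: P_def N_def)
    have PN: "P \<subseteq> I" "N \<subseteq> I" "\<And>v. v \<in> P \<Longrightarrow> m v \<noteq> 0" "\<And>v. v \<in> N \<Longrightarrow> m v \<noteq> 0" "P \<inter> N = {}"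
      by (auto simp: P_def N_def)
    have hit: "v \<in> ?H \<longleftrightarrow> v \<in> P \<union> N \<and> (\<forall>u\<in>I. m u = 0 \<longrightarrow> 0 \<le> l u) \<and> t p \<le> t v \<and> t v \<le> t n" for v
    proof
      assume "v \<in> ?H"
      then have v: "v \<in> I" "m v \<noteq> 0" "\<And>u. u \<in> I \<Longrightarrow> 0 \<le> l u + t v * m u"
        unfolding H by auto
      have "0 \<le> l u" if "u \<in> I" "m u = 0" for u
        using v(3)[OF that(1)] that by simp
      moreover have "t p \<le> t v" "t v \<le> t n"
        using v(3)[of p] v(3)[of n] leP[OF p(1)] leN[OF n(1)] p(1) n(1) PN by auto
      ultimately show "v \<in> P \<union> N \<and> (\<forall>u\<in>I. m u = 0 \<longrightarrow> 0 \<le> l u) \<and> t p \<le> t v \<and> t v \<le> t n"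
        using IPN[OF v(1)] v(2) by auto
    next
      assume v: "v \<in> P \<union> N \<and> (\<forall>u\<in>I. m u = 0 \<longrightarrow> 0 \<le> l u) \<and> t p \<le> t v \<and> t v \<le> t n"
      have "0 \<le> l u + t v * m u" if u: "u \<in> I" for u
        using IPN[OF u]
      proof (elim disjE)
        assume "u \<in> P" then show ?thesis using leP p(2)[of u] v by force
      next
        assume "u \<in> N" then show ?thesis using leN n(2)[of u] v by force
      qed (use u v in auto)
      then show "v \<in> ?H" unfolding H using v PN by auto
    qed
    \<comment> \<open>Coordinates of zero slope are constant along the line: if one is negative
      nothing is hit, and otherwise only the two ends of the interval from \<open>t p\<close> to
      \<open>t n\<close> can be hits.\<close>
    have "?H = {} \<or> ?H = {p, n}"
    proof (cases "(\<forall>u\<in>I. m u = 0 \<longrightarrow> 0 \<le> l u) \<and> t p \<le> t n")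
      case True
      have "v = p" if "v \<in> P" "t p \<le> t v" for v
        using eq[of v p] p(2)[OF that(1)] that PN p(1) by auto
      moreover have "v = n" if "v \<in> N" "t v \<le> t n" for v
        using eq[of v n] n(2)[OF that(1)] that PN n(1) by auto
      ultimately have "v \<in> ?H \<longleftrightarrow> v = p \<or> v = n" for v
        unfolding hit using True p(1) n(1) by blast
      then show ?thesis by blast
    next
      case False
      then have "v \<notin> ?H" for v unfolding hit by auto
      then show ?thesis by blast
    qed
    moreover have "p \<noteq> n" using p(1) n(1) PN by auto
    ultimately have "even (card ?H)" by (elim disjE) (simp_all only: card.empty, simp_all)
    then show ?thesis using p(1) n(1) by (force simp: P_def N_def)
  qed
qed

section \<open>Parity of the facets hit by a generic ray\<close>

lemma sum_scaleR_in_span: "(\<Sum>v\<in>\<rho>. c v *\<^sub>R a v) \<in> span (a ` \<rho>)"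
  by (rule span_sum, rule span_scale, rule span_base) simp

lemma span_image_obtain:
  fixes a :: "'v \<Rightarrow> 'b::real_vector"
  assumes "finite \<sigma>" "w \<in> span (a ` \<sigma>)"
  obtains c where "(\<Sum>v\<in>\<sigma>. c v *\<^sub>R a v) = w"
proof -
  let ?R = "range (\<lambda>c. \<Sum>v\<in>\<sigma>. c v *\<^sub>R a v)"
  have "subspace ?R"
  proof (rule subspaceI)
    show "0 \<in> ?R" by (rule image_eqI[of _ _ "\<lambda>_. 0"]) auto
  next
    fix x y assume "x \<in> ?R" "y \<in> ?R"
    then obtain c e where "x = (\<Sum>v\<in>\<sigma>. c v *\<^sub>R a v)" "y = (\<Sum>v\<in>\<sigma>. e v *\<^sub>R a v)" by auto
    then show "x + y \<in> ?R"
      by (intro image_eqI[of _ _ "\<lambda>v. c v + e v"]) (auto simp: scaleR_add_left sum.distrib)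
  next
    fix r x assume "x \<in> ?R"
    then obtain c where "x = (\<Sum>v\<in>\<sigma>. c v *\<^sub>R a v)" by auto
    then show "r *\<^sub>R x \<in> ?R"
      by (intro image_eqI[of _ _ "\<lambda>v. r * c v"]) (auto simp: scaleR_sum_right)
  qed
  moreover have "a ` \<sigma> \<subseteq> ?R"
  proof
    fix x assume "x \<in> a ` \<sigma>"
    then obtain k where k: "k \<in> \<sigma>" "x = a k" by auto
    have "(\<Sum>v\<in>\<sigma>. (if v = k then 1 else 0) *\<^sub>R a v) = (\<Sum>v\<in>\<sigma>. if v = k then a k else 0)"
      by (intro sum.cong) auto
    also have "\<dots> = x" using k assms(1) by simp
    finally show "x \<in> ?R" by (intro image_eqI[of _ _ "\<lambda>v. if v = k then 1 else 0"]) auto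
  qed
  ultimately have "span (a ` \<sigma>) \<subseteq> ?R" by (rule span_minimal[rotated])
  then show ?thesis using assms(2) that by auto
qed

text \<open>A zero coefficient could be dropped, leaving a relation on a proper face.\<close>

lemma captures_proper_pos:
  assumes "finite \<sigma>" "\<And>\<rho>. \<rho> \<subset> \<sigma> \<Longrightarrow> \<not> captures a \<rho>"
    and c: "\<And>v. v \<in> \<sigma> \<Longrightarrow> 0 \<le> c v" "\<exists>v\<in>\<sigma>. c v \<noteq> 0" "(\<Sum>v\<in>\<sigma>. c v *\<^sub>R a v) = 0"
    and v: "v \<in> \<sigma>"
  shows "0 < c v"
proof (rule ccontr)
  assume "\<not> 0 < c v"
  then have z: "c v = 0" using c(1)[OF v] by simp
  have "(\<Sum>u\<in>\<sigma> - {v}. c u *\<^sub>R a u) = 0"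
    using sum_scaleR_mono_neutral[of \<sigma> "\<sigma> - {v}" c a] assms(1) c(3) z by auto
  moreover have "\<exists>u\<in>\<sigma> - {v}. c u \<noteq> 0" using c(2) z by auto
  ultimately have "captures a (\<sigma> - {v})" unfolding captures_def using c(1) by blast
  then show False using assms(2)[of "\<sigma> - {v}"] v by blast
qed

text \<open>There are \<open>card B + 1\<close> vectors, yet their span misses \<open>w\<close>, so
  they satisfy at least two independent relations. Moving from a capturing relation along another
  one until a coefficient vanishes would make a proper face capture.\<close>

lemma not_captures_if_deficient:
  fixes a :: "'v \<Rightarrow> 'b::real_vector"
  assumes fin: "finite \<sigma>" "finite B" "card \<sigma> = Suc (card B)"
    and aB: "a ` \<sigma> \<subseteq> span B" "w \<in> span B" and w: "w \<notin> span (a ` \<sigma>)"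
    and proper: "\<And>\<rho>. \<rho> \<subset> \<sigma> \<Longrightarrow> \<not> captures a \<rho>"
  shows "\<not> captures a \<sigma>"
proof
  assume "captures a \<sigma>"
  then obtain m where m: "\<forall>v\<in>\<sigma>. 0 \<le> m v" "\<exists>v\<in>\<sigma>. m v \<noteq> 0" "(\<Sum>v\<in>\<sigma>. m v *\<^sub>R a v) = 0"
    unfolding captures_def by blast
  have mpos: "0 < m v" if "v \<in> \<sigma>" for v
    using captures_proper_pos[OF fin(1) proper _ m(2,3) that] m(1) by blast
  obtain v where v: "v \<in> \<sigma>" using m(2) by blast
  \<comment> \<open>With \<open>w\<close> in place of the vector at \<open>v\<close> there are still
    \<open>card B + 1\<close> vectors in \<open>span B\<close>, hence a relation. As
    \<open>w\<close> cannot take part in it, it is a relation of the old vectors with coefficient 0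
    at \<open>v\<close>.\<close>
  have "(a(v := w)) ` \<sigma> \<subseteq> span B" using aB by auto
  then obtain c where c: "\<exists>i\<in>\<sigma>. c i \<noteq> 0" "(\<Sum>i\<in>\<sigma>. c i *\<^sub>R (a(v := w)) i) = 0"
    using family_dependent[OF fin(1,2)] fin(3) by (metis lessI)
  have c2: "c v *\<^sub>R w + (\<Sum>i\<in>\<sigma> - {v}. c i *\<^sub>R a i) = 0"
    using c(2) fin(1) v by (simp add: sum.remove[of \<sigma> v])
  have cv: "c v = 0"
  proof (rule ccontr)
    assume "c v \<noteq> 0"
    then have "w = inverse (c v) *\<^sub>R (c v *\<^sub>R w)" by simp
    also have "c v *\<^sub>R w = - (\<Sum>i\<in>\<sigma> - {v}. c i *\<^sub>R a i)"
      using c2 by (simp only: eq_neg_iff_add_eq_0)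
    finally have "w = (- inverse (c v)) *\<^sub>R (\<Sum>i\<in>\<sigma> - {v}. c i *\<^sub>R a i)" by simp
    moreover have "(\<Sum>i\<in>\<sigma> - {v}. c i *\<^sub>R a i) \<in> span (a ` \<sigma>)"
      using sum_scaleR_in_span[of c a "\<sigma> - {v}"] span_mono[of "a ` (\<sigma> - {v})" "a ` \<sigma>"] by auto
    ultimately show False using w span_scale by metis
  qed
  have c3: "(\<Sum>i\<in>\<sigma>. c i *\<^sub>R a i) = 0"
    using c2 cv fin(1) v by (simp add: sum.remove[of \<sigma> v])
  obtain t where t: "\<And>i. i \<in> \<sigma> \<Longrightarrow> 0 \<le> m i - t * c i" "\<exists>i\<in>\<sigma>. m i - t * c i = 0"
    using subtract_until_zero[OF fin(1) _ c(1), of m] m(1) by blast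
  then obtain k where k: "k \<in> \<sigma>" "m k - t * c k = 0" by blast
  have "(\<Sum>i\<in>\<sigma>. (m i - t * c i) *\<^sub>R a i) = (\<Sum>i\<in>\<sigma>. m i *\<^sub>R a i) - t *\<^sub>R (\<Sum>i\<in>\<sigma>. c i *\<^sub>R a i)"
    by (simp add: scaleR_left_diff_distrib sum_subtractf scaleR_sum_right)
  then have "(\<Sum>i\<in>\<sigma>. (m i - t * c i) *\<^sub>R a i) = 0" using c3 m(3) by simp
  \<comment> \<open>The move leaves the coefficient at \<open>v\<close> untouched, so the new
    relation is nontrivial.\<close>
  moreover have "m v - t * c v \<noteq> 0" using mpos[OF v] cv by simp
  ultimately have "0 < m k - t * c k"
    by (intro captures_proper_pos[OF fin(1) proper, where c = "\<lambda>i. m i - t * c i"]) (use t v k in auto)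
  then show False using k by simp
qed

text \<open>The coefficient vectors expressing \<open>w\<close> in terms of \<open>\<sigma>\<close> form a line, and genericity of \<open>w\<close>
  means that this line never meets two coordinate hyperplanes at the same point.\<close>

lemma odd_cone_facets_iff_captures:
  fixes a :: "'v \<Rightarrow> 'b::real_vector"
  assumes fin: "finite \<sigma>" "finite B" "card \<sigma> = Suc (card B)"
    and aB: "a ` \<sigma> \<subseteq> span B" "w \<in> span B"
    and gen: "\<And>\<rho>. \<rho> \<subseteq> \<sigma> \<Longrightarrow> card \<rho> < card B \<Longrightarrow> w \<notin> span (a ` \<rho>)"
    and proper: "\<And>\<rho>. \<rho> \<subset> \<sigma> \<Longrightarrow> \<not> captures a \<rho>"
  shows "odd (card {v\<in>\<sigma>. in_cone a (\<sigma> - {v}) w}) \<longleftrightarrow> captures a \<sigma>"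
proof (cases "w \<in> span (a ` \<sigma>)")
  case False
  have "\<not> in_cone a (\<sigma> - {v}) w" for v
    using False sum_scaleR_in_span[of _ a "\<sigma> - {v}"] span_mono[of "a ` (\<sigma> - {v})" "a ` \<sigma>"]
    by (auto simp: in_cone_def)
  then show ?thesis using not_captures_if_deficient[OF fin aB False proper] by simp
next
  case True
  then obtain l where l: "(\<Sum>v\<in>\<sigma>. l v *\<^sub>R a v) = w"
    using span_image_obtain[OF fin(1)] by blast
  obtain m where m: "\<exists>v\<in>\<sigma>. m v \<noteq> 0" "(\<Sum>v\<in>\<sigma>. m v *\<^sub>R a v) = 0"
    using family_dependent[OF fin(1,2) _ aB(1)] fin(3) by (metis lessI)
  obtain k where k: "k \<in> \<sigma>" "m k \<noteq> 0" using m(1) by blast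
  \<comment> \<open>Genericity enters here: with two zero coefficients, \<open>w\<close> would lie
    in the span of only \<open>card B - 1\<close> vectors.\<close>
  have two: "u = v" if c: "(\<Sum>v\<in>\<sigma>. c v *\<^sub>R a v) = w" and uv: "u \<in> \<sigma>" "v \<in> \<sigma>" "c u = 0" "c v = 0"
    for c u v
  proof (rule ccontr)
    assume ne: "u \<noteq> v"
    have "card (\<sigma> - {u, v}) < card B"
      using fin ne uv card_Diff_subset[of "{u, v}" \<sigma>] card_mono[of \<sigma> "{u, v}"] by force
    moreover have "(\<Sum>v\<in>\<sigma> - {u, v}. c v *\<^sub>R a v) = w"
      unfolding c[symmetric] by (rule sum_scaleR_mono_neutral[symmetric]) (use fin(1) uv in auto)
    ultimately show False
      using gen[of "\<sigma> - {u, v}"] sum_scaleR_in_span[of c a "\<sigma> - {u, v}"] by auto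
  qed
  have lm: "(\<Sum>v\<in>\<sigma>. (l v + t * m v) *\<^sub>R a v) = w" for t
  proof -
    have "(\<Sum>v\<in>\<sigma>. (l v + t * m v) *\<^sub>R a v) = w + t *\<^sub>R (\<Sum>v\<in>\<sigma>. m v *\<^sub>R a v)"
      unfolding l[symmetric] by (simp add: scaleR_add_left sum.distrib scaleR_sum_right)
    then show ?thesis using m(2) by simp
  qed
  \<comment> \<open>Relations are unique up to scaling, since two independent ones would give enough
    freedom to cancel two coefficients in a representation of \<open>w\<close>.\<close>
  have multiple: "\<exists>s. \<forall>v\<in>\<sigma>. n v = s * m v" if n: "(\<Sum>v\<in>\<sigma>. n v *\<^sub>R a v) = 0" for n
  proof (rule ccontr)
    assume *: "\<not> ?thesis"
    define s where "s = n k / m k"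
    obtain j where j: "j \<in> \<sigma>" "n j \<noteq> s * m j" using * by blast
    \<comment> \<open>\<open>x\<close> cancels the coefficient at \<open>k\<close>; as
      \<open>n v - s * m v\<close> vanishes for \<open>v = k\<close>, adding \<open>y\<close> times
      it cancels the one at \<open>j\<close> without disturbing \<open>k\<close>.\<close>
    define x where "x = - l k / m k"
    define y where "y = - (l j + x * m j) / (n j - s * m j)"
    let ?c = "\<lambda>v. l v + x * m v + y * (n v - s * m v)"
    have "(\<Sum>v\<in>\<sigma>. ?c v *\<^sub>R a v) =
       (\<Sum>v\<in>\<sigma>. (l v + x * m v) *\<^sub>R a v) + y *\<^sub>R ((\<Sum>v\<in>\<sigma>. n v *\<^sub>R a v) - s *\<^sub>R (\<Sum>v\<in>\<sigma>. m v *\<^sub>R a v))"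
      by (simp add: scaleR_add_left scaleR_left_diff_distrib right_diff_distrib scaleR_right_diff_distrib
          sum.distrib sum_subtractf scaleR_sum_right)
    then have "(\<Sum>v\<in>\<sigma>. ?c v *\<^sub>R a v) = w" using lm m(2) n by simp
    moreover have "?c k = 0" using k(2) by (simp add: x_def s_def)
    moreover have "?c j = 0" using j(2) by (simp add: y_def)
    ultimately have "k = j" by (rule two[where c = ?c, OF _ k(1) j(1)])
    then show False using j(2) k(2) by (simp add: s_def)
  qed
  have signs: "(\<forall>v\<in>\<sigma>. 0 < m v) \<or> (\<forall>v\<in>\<sigma>. m v < 0) \<longleftrightarrow> captures a \<sigma>"
  proof
    assume *: "(\<forall>v\<in>\<sigma>. 0 < m v) \<or> (\<forall>v\<in>\<sigma>. m v < 0)"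
    show "captures a \<sigma>"
    proof (cases "\<forall>v\<in>\<sigma>. 0 < m v")
      case True
      then show ?thesis unfolding captures_def using m by (intro exI[of _ m]) auto
    next
      case False
      then show ?thesis unfolding captures_def
        using m * by (intro exI[of _ "\<lambda>v. - m v"]) (auto simp: sum_negf)
    qed
  next
    assume "captures a \<sigma>"
    then obtain c where c: "\<forall>v\<in>\<sigma>. 0 \<le> c v" "\<exists>v\<in>\<sigma>. c v \<noteq> 0" "(\<Sum>v\<in>\<sigma>. c v *\<^sub>R a v) = 0"
      unfolding captures_def by blast
    obtain s where s: "\<forall>v\<in>\<sigma>. c v = s * m v" using multiple[OF c(3)] by blast
    have "0 < c v" if "v \<in> \<sigma>" for v
      using captures_proper_pos[OF fin(1) proper _ c(2,3) that] c(1) by blast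
    then show "(\<forall>v\<in>\<sigma>. 0 < m v) \<or> (\<forall>v\<in>\<sigma>. m v < 0)"
      using s by (cases "s > 0") (auto simp: zero_less_mult_iff)
  qed
  \<comment> \<open>The points of the line are the representations of \<open>w\<close>, and those
    supported on the facet opposite \<open>v\<close> have coordinate 0 at \<open>v\<close>, which
    fixes the parameter once \<open>m v\<close> is nonzero.\<close>
  have hits: "in_cone a (\<sigma> - {v}) w \<longleftrightarrow> m v \<noteq> 0 \<and> (\<forall>u\<in>\<sigma>. 0 \<le> l u + (- l v / m v) * m u)"
    if v: "v \<in> \<sigma>" for v
  proof
    assume "in_cone a (\<sigma> - {v}) w"
    then obtain c where c: "\<forall>u\<in>\<sigma> - {v}. 0 \<le> c u" "(\<Sum>u\<in>\<sigma> - {v}. c u *\<^sub>R a u) = w"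
      unfolding in_cone_def by blast
    define c' where "c' = c(v := 0)"
    have c': "(\<Sum>u\<in>\<sigma>. c' u *\<^sub>R a u) = w" "\<forall>u\<in>\<sigma>. 0 \<le> c' u" "c' v = 0"
      using c fin(1) v by (auto simp: c'_def sum.remove[of \<sigma> v])
    have "(\<Sum>u\<in>\<sigma>. (c' u - l u) *\<^sub>R a u) = 0"
      using c'(1) l by (simp add: scaleR_left_diff_distrib sum_subtractf)
    from multiple[OF this] obtain s where "\<forall>u\<in>\<sigma>. c' u - l u = s * m u" by blast
    then have s: "c' u = l u + s * m u" if "u \<in> \<sigma>" for u using that by (metis add.commute diff_add_cancel)
    \<comment> \<open>Otherwise coordinate \<open>v\<close> would be 0 along the whole line, also at
      the point where coordinate \<open>k\<close> vanishes, against \<open>two\<close>.\<close>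
    have mv: "m v \<noteq> 0"
    proof
      assume 0: "m v = 0"
      then have "l v = 0" using s[OF v] c'(3) by simp
      then have "k = v"
        using two[OF lm[of "- l k / m k"] k(1) v] 0 k(2) by simp
      then show False using k(2) 0 by simp
    qed
    moreover have "s = - l v / m v" using s[OF v] c'(3) mv by (simp add: field_simps)
    ultimately show "m v \<noteq> 0 \<and> (\<forall>u\<in>\<sigma>. 0 \<le> l u + (- l v / m v) * m u)"
      using s c'(2) by metis
  next
    assume *: "m v \<noteq> 0 \<and> (\<forall>u\<in>\<sigma>. 0 \<le> l u + (- l v / m v) * m u)"
    let ?c = "\<lambda>u. l u + (- l v / m v) * m u"
    have cv: "?c v = 0" using * by simp
    have "(\<Sum>u\<in>\<sigma> - {v}. ?c u *\<^sub>R a u) = (\<Sum>u\<in>\<sigma>. ?c u *\<^sub>R a u)"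
      by (rule sum_scaleR_mono_neutral[symmetric]) (use fin(1) cv in auto)
    then show "in_cone a (\<sigma> - {v}) w"
      unfolding in_cone_def using * lm[of "- l v / m v"] by (intro exI[of _ ?c]) auto
  qed
  have "odd (card {v\<in>\<sigma>. m v \<noteq> 0 \<and> (\<forall>u\<in>\<sigma>. 0 \<le> l u + (- l v / m v) * m u)}) \<longleftrightarrow>
        (\<forall>v\<in>\<sigma>. 0 < m v) \<or> (\<forall>v\<in>\<sigma>. m v < 0)"
  proof (rule odd_orthant_hits_iff[OF fin(1)])
    show "\<sigma> \<noteq> {}" using k(1) by auto
    show "u = v" if "u \<in> \<sigma>" "v \<in> \<sigma>" "l u + t * m u = 0" "l v + t * m v = 0" for t u v
      using two[OF lm[of t] that] .
    show "\<forall>v\<in>\<sigma>. 0 < m v" if "\<forall>v\<in>\<sigma>. 0 \<le> m v"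
      using captures_proper_pos[OF fin(1) proper _ m] that by blast
    show "\<forall>v\<in>\<sigma>. m v < 0" if "\<forall>v\<in>\<sigma>. m v \<le> 0"
    proof
      fix v assume "v \<in> \<sigma>"
      then have "0 < - m v"
        by (intro captures_proper_pos[OF fin(1) proper, where c = "\<lambda>v. - m v"])
          (use that m in \<open>auto simp: sum_negf\<close>)
      then show "m v < 0" by simp
    qed
  qed
  moreover have "{v\<in>\<sigma>. in_cone a (\<sigma> - {v}) w} =
      {v\<in>\<sigma>. m v \<noteq> 0 \<and> (\<forall>u\<in>\<sigma>. 0 \<le> l u + (- l v / m v) * m u)}"
    using hits by blast
  ultimately show ?thesis using signs by simp
qed

lemma sum_of_bool_bit: "finite I \<Longrightarrow> (\<Sum>v\<in>I. of_bool (P v) :: bit) = of_bool (odd (card {v\<in>I. P v}))"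
proof (induction I rule: finite_induct)
  case (insert x F)
  have "{v \<in> insert x F. P v} = (if P x then insert x {v\<in>F. P v} else {v\<in>F. P v})" by auto
  then show ?case using insert by (cases "P x") simp_all
qed simp

text \<open>In cochain terms: on such simplices the coboundary of \<open>in_cone\<close> is
  \<open>captures\<close>, modulo 2. This is the form that can be summed over chains.\<close>

lemma sum_cone_facets_eq_captures:
  fixes a :: "'v \<Rightarrow> 'b::real_vector"
  assumes "finite \<sigma>" "finite B" "card \<sigma> = Suc (card B)"
    and "a ` \<sigma> \<subseteq> span B" "w \<in> span B"
    and "\<And>\<rho>. \<rho> \<subseteq> \<sigma> \<Longrightarrow> card \<rho> < card B \<Longrightarrow> w \<notin> span (a ` \<rho>)"
    and "\<And>\<rho>. \<rho> \<subset> \<sigma> \<Longrightarrow> \<not> captures a \<rho>"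
  shows "(\<Sum>v\<in>\<sigma>. of_bool (in_cone a (\<sigma> - {v}) w) :: bit) = of_bool (captures a \<sigma>)"
  using odd_cone_facets_iff_captures[OF assms] assms(1) by (simp only: sum_of_bool_bit)

section \<open>Generic perturbation\<close>

text \<open>Two different parameters in \<open>S\<close> would, by subtraction, put a nonzero
  multiple of \<open>q\<close> in \<open>S\<close>; so at most one parameter is bad.\<close>

lemma eventually_line_avoids_subspace:
  fixes p q :: "'b::real_vector"
  assumes "subspace S" "q \<notin> S"
  shows "\<forall>\<^sub>F t in at_right (0::real). p + t *\<^sub>R q \<notin> S"
proof (cases "\<exists>t. p + t *\<^sub>R q \<in> S")
  case True
  then obtain s where s: "p + s *\<^sub>R q \<in> S" by blast
  have "p + t *\<^sub>R q \<notin> S" if "t \<noteq> s" for t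
  proof
    assume "p + t *\<^sub>R q \<in> S"
    then have "(p + t *\<^sub>R q) - (p + s *\<^sub>R q) \<in> S" using s assms(1) by (intro subspace_diff)
    then have "(t - s) *\<^sub>R q \<in> S" by (simp add: scaleR_left_diff_distrib)
    then have "inverse (t - s) *\<^sub>R ((t - s) *\<^sub>R q) \<in> S"
      by (rule subspace_scale[OF assms(1)])
    then show False using that assms(2) by simp
  qed
  moreover have "\<forall>\<^sub>F t in at_right (0::real). t \<noteq> s" by (rule eventually_neq_at_within)
  ultimately show ?thesis by (auto elim: eventually_mono)
qed auto

text \<open>A real vector space is not a finite union of proper subspaces. A vector that avoids the
  earlier subspaces but lies in the new \<open>S\<close> serves as a small perturbation of some
  \<open>r\<close> outside \<open>S\<close>.\<close>

lemma exists_avoiding_subspaces: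
  fixes W :: "'b::real_vector set"
  assumes "finite \<S>" "subspace W" "\<And>S. S \<in> \<S> \<Longrightarrow> subspace S \<and> \<not> W \<subseteq> S"
  shows "\<exists>q\<in>W. \<forall>S\<in>\<S>. q \<notin> S"
  using assms(1,3)
proof (induction \<S> rule: finite_induct)
  case empty
  then show ?case using subspace_0[OF assms(2)] by blast
next
  case (insert S \<S>)
  then obtain q where q: "q \<in> W" "\<And>S. S \<in> \<S> \<Longrightarrow> q \<notin> S" by force
  obtain r where r: "r \<in> W" "r \<notin> S" using insert.prems by blast
  show ?case
  proof (cases "q \<in> S")
    case True
    have "\<forall>\<^sub>F t in at_right (0::real). \<forall>R\<in>\<S>. r + t *\<^sub>R q \<notin> R"
      using insert by (intro eventually_ball_finite ballI eventually_line_avoids_subspace q) auto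
    then obtain t :: real where t: "\<forall>R\<in>\<S>. r + t *\<^sub>R q \<notin> R"
      using eventually_happens trivial_limit_at_right_real by blast
    have S: "subspace S" using insert.prems by blast
    have "r + t *\<^sub>R q \<notin> S"
    proof
      assume "r + t *\<^sub>R q \<in> S"
      then have "(r + t *\<^sub>R q) - t *\<^sub>R q \<in> S"
        using True S by (intro subspace_diff subspace_scale) auto
      then show False using r by simp
    qed
    moreover have "r + t *\<^sub>R q \<in> W"
      using r q assms(2) by (intro subspace_add subspace_scale) auto
    ultimately show ?thesis using t by blast
  qed (use q in blast)
qed

text \<open>Only the direction has to avoid the finitely many small spans; a line in that direction
  through any base point then avoids them for small positive \<open>t\<close>. One \<open>q\<close>
  thus serves every \<open>p\<close>.\<close>

lemma exists_generic_direction: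
  fixes a :: "'v \<Rightarrow> 'b::real_vector"
  assumes "finite U" "finite B" "independent B"
  obtains q where "q \<in> span B"
    "\<And>p. \<forall>\<^sub>F t in at_right (0::real). \<forall>\<rho>\<subseteq>U. card \<rho> < card B \<longrightarrow> p + t *\<^sub>R q \<notin> span (a ` \<rho>)"
proof -
  define \<S> where "\<S> = (\<lambda>\<rho>. span (a ` \<rho>)) ` {\<rho>\<in>Pow U. card \<rho> < card B}"
  have fin: "finite \<S>" unfolding \<S>_def using assms(1) by auto
  have sub: "subspace S \<and> \<not> span B \<subseteq> S" if "S \<in> \<S>" for S
  proof -
    obtain \<rho> where \<rho>: "\<rho> \<subseteq> U" "card \<rho> < card B" "S = span (a ` \<rho>)"
      using \<open>S \<in> \<S>\<close> by (auto simp: \<S>_def)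
    have "finite \<rho>" using \<rho>(1) assms(1) finite_subset by blast
    then have "\<not> B \<subseteq> span (a ` \<rho>)"
      using independent_span_bound[OF _ assms(3), of "a ` \<rho>"] card_image_le[of \<rho> a] \<rho>(2) by fastforce
    then show ?thesis using \<rho>(3) span_superset[of B] by auto
  qed
  then obtain q where q: "q \<in> span B" "\<And>S. S \<in> \<S> \<Longrightarrow> q \<notin> S"
    using exists_avoiding_subspaces[OF fin subspace_span[of B]] by blast
  have "\<forall>\<^sub>F t in at_right (0::real). \<forall>\<rho>\<subseteq>U. card \<rho> < card B \<longrightarrow> p + t *\<^sub>R q \<notin> span (a ` \<rho>)" for p
  proof -
    have "\<forall>\<^sub>F t in at_right (0::real). \<forall>S\<in>\<S>. p + t *\<^sub>R q \<notin> S"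
      using sub q fin by (intro eventually_ball_finite ballI eventually_line_avoids_subspace) auto
    then show ?thesis by (rule eventually_mono) (auto simp: \<S>_def)
  qed
  then show ?thesis using that q by blast
qed

lemma independent_family_obtain:
  fixes a :: "'v \<Rightarrow> 'b::real_vector"
  assumes fin: "finite \<tau>" "finite B" "card \<tau> = card B" and aB: "a ` \<tau> \<subseteq> span B" "w \<in> span B"
    and indep: "\<And>c. (\<Sum>v\<in>\<tau>. c v *\<^sub>R a v) = 0 \<Longrightarrow> \<forall>v\<in>\<tau>. c v = 0"
  obtains c where "(\<Sum>v\<in>\<tau>. c v *\<^sub>R a v) = w"
proof -
  \<comment> \<open>The index \<open>None\<close> carries \<open>w\<close> beside the vectors of
    \<open>\<tau>\<close>. A relation of these \<open>card B + 1\<close> vectors must involve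
    \<open>w\<close> and can be solved for it.\<close>
  let ?f = "case_option w a"
  have reindex: "(\<Sum>i\<in>insert None (Some ` \<tau>). c i *\<^sub>R ?f i) = c None *\<^sub>R w + (\<Sum>v\<in>\<tau>. c (Some v) *\<^sub>R a v)"
    for c using fin(1) by (simp add: sum.reindex)
  have "card (insert None (Some ` \<tau>)) = Suc (card B)"
    using fin by (simp add: card_image)
  then have less: "card B < card (insert None (Some ` \<tau>))" by simp
  have img: "?f ` insert None (Some ` \<tau>) \<subseteq> span B"
    using aB by auto
  obtain c where c0: "\<exists>i\<in>insert None (Some ` \<tau>). c i \<noteq> 0"
      "(\<Sum>i\<in>insert None (Some ` \<tau>). c i *\<^sub>R ?f i) = 0"
    by (rule family_dependent[OF _ fin(2) less img]) (use fin(1) in simp)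
  note c = c0(1) c0(2)[unfolded reindex]
  have "c None \<noteq> 0"
  proof
    assume 0: "c None = 0"
    then have "(\<Sum>v\<in>\<tau>. c (Some v) *\<^sub>R a v) = 0" using c(2) by simp
    then have "\<forall>v\<in>\<tau>. c (Some v) = 0" by (rule indep)
    then show False using c(1) 0 by blast
  qed
  then have "w = inverse (c None) *\<^sub>R (c None *\<^sub>R w)" by simp
  also have "c None *\<^sub>R w = - (\<Sum>v\<in>\<tau>. c (Some v) *\<^sub>R a v)"
    using c(2) by (simp only: eq_neg_iff_add_eq_0)
  finally have "(\<Sum>v\<in>\<tau>. (- inverse (c None) * c (Some v)) *\<^sub>R a v) = w"
    by (simp add: scaleR_sum_right sum_negf)
  then show ?thesis by (rule that)
qed

lemma eventually_at_right_affine_pos: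
  fixes x y :: real
  assumes "0 < x"
  shows "\<forall>\<^sub>F t in at_right 0. 0 < x + t * y"
proof -
  have "((\<lambda>t. x + t * y) \<longlongrightarrow> x + 0 * y) (at_right 0)" by (intro tendsto_intros)
  then show ?thesis using assms by (intro order_tendstoD(1)[of _ x]) simp_all
qed

text \<open>If the vectors are independent, coefficients are unique and some coefficient of
  \<open>p\<close> is negative, which persists for small \<open>t\<close>. If they are dependent, a
  point of the cone lies in the span of fewer than \<open>card B\<close> vectors, against
  genericity.\<close>

lemma eventually_not_in_cone:
  fixes a :: "'v \<Rightarrow> 'b::real_vector"
  assumes fin: "finite \<tau>" "finite B" "card \<tau> = card B" and aB: "a ` \<tau> \<subseteq> span B" "p \<in> span B" "q \<in> span B"
    and p: "\<not> in_cone a \<tau> p"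
    and gen: "\<forall>\<^sub>F t in at_right (0::real). \<forall>\<rho>\<subseteq>\<tau>. card \<rho> < card B \<longrightarrow> p + t *\<^sub>R q \<notin> span (a ` \<rho>)"
  shows "\<forall>\<^sub>F t in at_right (0::real). \<not> in_cone a \<tau> (p + t *\<^sub>R q)"
proof (cases "\<forall>c. (\<Sum>v\<in>\<tau>. c v *\<^sub>R a v) = 0 \<longrightarrow> (\<forall>v\<in>\<tau>. c v = 0)")
  case True
  then have indep: "\<And>c. (\<Sum>v\<in>\<tau>. c v *\<^sub>R a v) = 0 \<Longrightarrow> \<forall>v\<in>\<tau>. c v = 0" by blast
  obtain l e where l: "(\<Sum>v\<in>\<tau>. l v *\<^sub>R a v) = p" and e: "(\<Sum>v\<in>\<tau>. e v *\<^sub>R a v) = q"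
    using independent_family_obtain[OF fin aB(1) _ indep] aB(2,3) by metis
  have "\<not> (\<forall>v\<in>\<tau>. 0 \<le> l v)" using p l unfolding in_cone_def by blast
  then obtain v where v: "v \<in> \<tau>" "l v < 0" by (meson not_le)
  then have "\<forall>\<^sub>F t in at_right (0::real). 0 < - l v + t * - e v"
    by (intro eventually_at_right_affine_pos) simp
  then show ?thesis
  proof (rule eventually_mono)
    fix t assume t: "0 < - l v + t * - e v"
    show "\<not> in_cone a \<tau> (p + t *\<^sub>R q)"
    proof
      assume "in_cone a \<tau> (p + t *\<^sub>R q)"
      then obtain c where c: "\<forall>v\<in>\<tau>. 0 \<le> c v" "(\<Sum>v\<in>\<tau>. c v *\<^sub>R a v) = p + t *\<^sub>R q"
        unfolding in_cone_def by blast
      have "(\<Sum>v\<in>\<tau>. (c v - (l v + t * e v)) *\<^sub>R a v) = 0"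
        by (simp add: scaleR_left_diff_distrib scaleR_add_left sum_subtractf sum.distrib c(2) l
            flip: scaleR_scaleR scaleR_sum_right) (simp add: e)
      then have "c v - (l v + t * e v) = 0" using indep[of "\<lambda>v. c v - (l v + t * e v)"] v(1) by blast
      then show False using t c(1) v(1) by force
    qed
  qed
next
  case False
  then obtain n k where n: "(\<Sum>v\<in>\<tau>. n v *\<^sub>R a v) = 0" and k: "k \<in> \<tau>" "n k \<noteq> 0" by blast
  have card: "card (\<tau> - {k}) < card B"
    using fin k by (metis card_Diff1_less)
  show ?thesis
    using gen
  proof (rule eventually_mono)
    fix t assume t: "\<forall>\<rho>\<subseteq>\<tau>. card \<rho> < card B \<longrightarrow> p + t *\<^sub>R q \<notin> span (a ` \<rho>)"
    show "\<not> in_cone a \<tau> (p + t *\<^sub>R q)"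
    proof
      assume "in_cone a \<tau> (p + t *\<^sub>R q)"
      then obtain c where c: "(\<Sum>v\<in>\<tau>. c v *\<^sub>R a v) = p + t *\<^sub>R q"
        unfolding in_cone_def by blast
      \<comment> \<open>Subtracting this multiple of the relation \<open>n\<close> clears the
        coefficient at \<open>k\<close>. It may spoil signs, but only the span matters now.\<close>
      let ?c = "\<lambda>v. c v - c k / n k * n v"
      have "(\<Sum>v\<in>\<tau>. ?c v *\<^sub>R a v) = p + t *\<^sub>R q - (c k / n k) *\<^sub>R (\<Sum>v\<in>\<tau>. n v *\<^sub>R a v)"
        by (simp add: scaleR_left_diff_distrib sum_subtractf c scaleR_sum_right)
      also have "\<dots> = p + t *\<^sub>R q" using n by simp
      also have "(\<Sum>v\<in>\<tau>. ?c v *\<^sub>R a v) = (\<Sum>v\<in>\<tau> - {k}. ?c v *\<^sub>R a v)"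
        by (rule sum_scaleR_mono_neutral) (use fin k in auto)
      finally have "p + t *\<^sub>R q \<in> span (a ` (\<tau> - {k}))"
        using sum_scaleR_in_span[of ?c a "\<tau> - {k}"] by simp
      then show False using t card by blast
    qed
  qed
qed

text \<open>Subsets pair off as \<open>K\<close> and \<open>insert j K\<close>, and equal terms
  cancel modulo 2.\<close>

lemma sum_Pow_toggle_bit:
  fixes g :: "'i set \<Rightarrow> bit"
  assumes "finite J" "j \<in> J" "\<And>K. K \<subseteq> J - {j} \<Longrightarrow> g (insert j K) = g K"
  shows "(\<Sum>K\<in>Pow J. g K) = 0"
proof -
  have P: "Pow J = Pow (J - {j}) \<union> insert j ` Pow (J - {j})"
    using Pow_insert[of j "J - {j}"] assms(2) by (simp add: insert_absorb)
  have "(\<Sum>K\<in>Pow J. g K) = (\<Sum>K\<in>Pow (J - {j}). g K) + (\<Sum>K\<in>insert j ` Pow (J - {j}). g K)"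
    unfolding P by (rule sum.union_disjoint) (use assms(1) in auto)
  also have "(\<Sum>K\<in>insert j ` Pow (J - {j}). g K) = (\<Sum>K\<in>Pow (J - {j}). g (insert j K))"
    by (rule sum.reindex_cong[of "insert j"]) (auto simp: inj_on_def)
  also have "\<dots> = (\<Sum>K\<in>Pow (J - {j}). g K)"
    by (rule sum.cong) (use assms(3) in auto)
  finally show ?thesis by simp
qed

section \<open>The colourful Caratheodory theorem\<close>

definition in_conv :: "('v \<Rightarrow> 'b::real_vector) \<Rightarrow> 'v set \<Rightarrow> 'b \<Rightarrow> bool" where
  "in_conv a \<sigma> w \<longleftrightarrow>
     (\<exists>c. (\<forall>v\<in>\<sigma>. 0 \<le> c v) \<and> sum c \<sigma> = 1 \<and> (\<Sum>v\<in>\<sigma>. c v *\<^sub>R a v) = w)"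

lemma in_conv_mono:
  assumes "in_conv a \<rho> w" "\<rho> \<subseteq> \<sigma>" "finite \<sigma>"
  shows "in_conv a \<sigma> w"
proof -
  obtain c where c: "\<forall>v\<in>\<rho>. 0 \<le> c v" "sum c \<rho> = 1" "(\<Sum>v\<in>\<rho>. c v *\<^sub>R a v) = w"
    using assms(1) unfolding in_conv_def by blast
  define e where "e v = (if v \<in> \<rho> then c v else 0)" for v
  have "sum e \<sigma> = sum e \<rho>"
    by (rule sum.mono_neutral_right) (use assms in \<open>auto simp: e_def\<close>)
  moreover have "(\<Sum>v\<in>\<sigma>. e v *\<^sub>R a v) = (\<Sum>v\<in>\<rho>. e v *\<^sub>R a v)"
    by (rule sum_scaleR_mono_neutral) (use assms in \<open>auto simp: e_def\<close>)
  ultimately show ?thesis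
    unfolding in_conv_def using c by (intro exI[of _ e]) (auto simp: e_def)
qed

lemma in_conv_drop_zero:
  assumes "finite \<sigma>" "k \<in> \<sigma>" "c k = 0"
    and "\<And>v. v \<in> \<sigma> \<Longrightarrow> 0 \<le> c v" "sum c \<sigma> = 1" "(\<Sum>v\<in>\<sigma>. c v *\<^sub>R a v) = w"
  shows "in_conv a (\<sigma> - {k}) w"
  unfolding in_conv_def
  by (rule exI[of _ c]) (use assms in \<open>auto simp: sum.remove[of \<sigma> k]\<close>)

lemma linear_sum_scaleR:
  fixes \<phi> :: "'b::real_vector \<Rightarrow> real"
  assumes "linear \<phi>"
  shows "\<phi> (\<Sum>v\<in>\<sigma>. c v *\<^sub>R a v) = (\<Sum>v\<in>\<sigma>. c v * \<phi> (a v))"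
  by (simp add: linear_sum[OF assms] linear_scale[OF assms])

lemma captures_linear_nonpos:
  fixes \<phi> :: "'b::real_vector \<Rightarrow> real"
  assumes "finite \<sigma>" "captures a \<sigma>" "linear \<phi>"
  shows "\<exists>v\<in>\<sigma>. \<phi> (a v) \<le> 0"
proof (rule ccontr)
  assume *: "\<not> ?thesis"
  obtain c where c: "\<forall>v\<in>\<sigma>. 0 \<le> c v" "\<exists>v\<in>\<sigma>. c v \<noteq> 0" "(\<Sum>v\<in>\<sigma>. c v *\<^sub>R a v) = 0"
    using assms(2) unfolding captures_def by blast
  obtain k where k: "k \<in> \<sigma>" "c k \<noteq> 0" using c(2) by blast
  have "0 < (\<Sum>v\<in>\<sigma>. c v * \<phi> (a v))"
  proof (rule sum_pos2[OF assms(1) k(1)])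
    show "0 < c k * \<phi> (a k)" using k c(1) * by (metis mult_pos_pos not_le order_le_less)
    show "0 \<le> c v * \<phi> (a v)" if "v \<in> \<sigma>" for v using that c(1) * by (meson mult_nonneg_nonneg nle_le)
  qed
  also have "(\<Sum>v\<in>\<sigma>. c v * \<phi> (a v)) = \<phi> 0"
    unfolding c(3)[symmetric] linear_sum_scaleR[OF assms(3)] ..
  finally show False using linear_0[OF assms(3)] by simp
qed

text \<open>Values that are all at least \<open>\<phi> p\<close> and average to
  \<open>\<phi> p\<close> with positive weights are equal to it. Since \<open>\<phi> p > 0\<close>,
  every linear relation then has coefficient sum 0, so moving along it preserves convex combinations
  for \<open>p\<close> and ends on a smaller face, against minimality.\<close>

lemma minimal_conv_independent:
  fixes a :: "'v \<Rightarrow> 'b::real_vector" and \<phi> :: "'b \<Rightarrow> real"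
  assumes fin: "finite \<sigma>" and lin: "linear \<phi>" and pos: "0 < \<phi> p"
    and p: "in_conv a \<sigma> p" and minimal: "\<And>\<rho>. \<rho> \<subset> \<sigma> \<Longrightarrow> \<not> in_conv a \<rho> p"
    and above: "\<And>v. v \<in> \<sigma> \<Longrightarrow> \<phi> p \<le> \<phi> (a v)"
  obtains c where "\<And>v. v \<in> \<sigma> \<Longrightarrow> 0 < c v" "(\<Sum>v\<in>\<sigma>. c v *\<^sub>R a v) = p"
    "\<And>v. v \<in> \<sigma> \<Longrightarrow> \<phi> (a v) = \<phi> p"
    "\<And>n. (\<Sum>v\<in>\<sigma>. n v *\<^sub>R a v) = 0 \<Longrightarrow> \<forall>v\<in>\<sigma>. n v = 0"
proof -
  obtain c where c: "\<And>v. v \<in> \<sigma> \<Longrightarrow> 0 \<le> c v" "sum c \<sigma> = 1" "(\<Sum>v\<in>\<sigma>. c v *\<^sub>R a v) = p"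
    using p unfolding in_conv_def by blast
  have nz: "e k \<noteq> 0" if "k \<in> \<sigma>" "\<And>v. v \<in> \<sigma> \<Longrightarrow> 0 \<le> e v" "sum e \<sigma> = 1" "(\<Sum>v\<in>\<sigma>. e v *\<^sub>R a v) = p" for e k
    using in_conv_drop_zero[OF fin that(1) _ that(2-4)] minimal[of "\<sigma> - {k}"] that(1) by blast
  have cpos: "0 < c v" if "v \<in> \<sigma>" for v
    using nz[OF that c] c(1)[OF that] by simp
  have "(\<Sum>v\<in>\<sigma>. c v * (\<phi> (a v) - \<phi> p)) = (\<Sum>v\<in>\<sigma>. c v * \<phi> (a v)) - sum c \<sigma> * \<phi> p"
    by (simp add: right_diff_distrib sum_subtractf sum_distrib_right)
  also have "\<dots> = 0" using linear_sum_scaleR[OF lin, of c a \<sigma>] c(2,3) by simp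
  finally have "\<forall>v\<in>\<sigma>. c v * (\<phi> (a v) - \<phi> p) = 0"
    using sum_nonneg_eq_0_iff[OF fin, of "\<lambda>v. c v * (\<phi> (a v) - \<phi> p)"] c(1) above by simp
  then have eq: "\<phi> (a v) = \<phi> p" if "v \<in> \<sigma>" for v
    using cpos[OF that] that by force
  have "\<forall>v\<in>\<sigma>. n v = 0" if n: "(\<Sum>v\<in>\<sigma>. n v *\<^sub>R a v) = 0" for n
  proof (rule ccontr)
    assume "\<not> (\<forall>v\<in>\<sigma>. n v = 0)"
    then have nn: "\<exists>v\<in>\<sigma>. n v \<noteq> 0" by blast
    have "0 = (\<Sum>v\<in>\<sigma>. n v * \<phi> (a v))"
      using linear_sum_scaleR[OF lin, of n a \<sigma>] linear_0[OF lin] n by simp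
    also have "\<dots> = sum n \<sigma> * \<phi> p" by (simp add: eq sum_distrib_right)
    finally have n0: "sum n \<sigma> = 0" using pos by simp
    obtain t where t: "\<And>v. v \<in> \<sigma> \<Longrightarrow> 0 \<le> c v - t * n v" "\<exists>v\<in>\<sigma>. c v - t * n v = 0"
      using subtract_until_zero[of \<sigma> c n] fin c(1) nn by blast
    obtain k where k: "k \<in> \<sigma>" "c k - t * n k = 0" using t(2) by blast
    have "sum (\<lambda>v. c v - t * n v) \<sigma> = 1"
      using c(2) n0 by (simp add: sum_subtractf flip: sum_distrib_left)
    moreover have "(\<Sum>v\<in>\<sigma>. (c v - t * n v) *\<^sub>R a v) = p - t *\<^sub>R (\<Sum>v\<in>\<sigma>. n v *\<^sub>R a v)"
      using c(3) by (simp add: scaleR_left_diff_distrib sum_subtractf scaleR_sum_right)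
    then have "(\<Sum>v\<in>\<sigma>. (c v - t * n v) *\<^sub>R a v) = p" using n by simp
    ultimately have "c k - t * n k \<noteq> 0"
      by (intro nz[of k "\<lambda>v. c v - t * n v"]) (use k t in auto)
    then show False using k(2) by simp
  qed
  then show ?thesis using that cpos c(3) eq by blast
qed

lemma discrete_join_image:
  assumes "disjoint_family_on V I" "finite J" "J \<subseteq> I" "\<And>j. j \<in> J \<Longrightarrow> g j \<in> V j"
  shows "g ` J \<in> discrete_join I V"
proof -
  have "card (g ` J \<inter> V i) \<le> 1" if i: "i \<in> I" for i
  proof -
    have "g j = g i" if j: "j \<in> J" "g j \<in> V i" for j
    proof (rule ccontr)
      assume "g j \<noteq> g i"
      then have "V j \<inter> V i = {}"
        using disjoint_family_onD[OF assms(1), of j i] assms(3) i j(1) by auto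
      then show False using assms(4)[OF j(1)] j(2) by blast
    qed
    then have "g ` J \<inter> V i \<subseteq> {g i}" by blast
    then show ?thesis using card_mono[of "{g i}" "g ` J \<inter> V i"] by simp
  qed
  then show ?thesis
    using assms(2,3,4) unfolding discrete_join_def by blast
qed

text \<open>Here \<open>p\<close> plays the role of the point nearest to the origin of the union of all colourful
  simplices, and \<open>\<phi>\<close> that of the inner product with \<open>p\<close>. The minimal face \<open>\<alpha> ` J\<close> containing \<open>p\<close>
  misses exactly one colour \<open>i\<close>. Below the hyperplane \<open>\<phi> = \<phi> p\<close> every other colour has a
  point \<open>\<beta> j\<close>. The cone with apex \<open>u\<close> of colour \<open>i\<close> over the cross-polytope with antipodal vertices
  \<open>\<alpha> j\<close>, \<open>\<beta> j\<close> has boundary the cross-polytope, which a ray near \<open>p\<close> meets only in \<open>\<alpha> ` J\<close>;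
  so an odd number of the simplices of the cone contain the origin.\<close>

lemma colourful_caratheodory_from_nearest:
  fixes a :: "'v \<Rightarrow> 'b::real_vector" and V :: "'i \<Rightarrow> 'v set" and \<phi> :: "'b \<Rightarrow> real"
  assumes I: "finite I" "card I = Suc (card B)" and B: "finite B" "independent B"
    and V: "\<And>i. i \<in> I \<Longrightarrow> finite (V i)" "\<And>i. i \<in> I \<Longrightarrow> V i \<noteq> {}" and disj: "disjoint_family_on V I"
    and aB: "\<And>i v. i \<in> I \<Longrightarrow> v \<in> V i \<Longrightarrow> a v \<in> span B"
    and pairs: "\<And>i j. i \<in> I \<Longrightarrow> j \<in> I \<Longrightarrow> i \<noteq> j \<Longrightarrow> captures a (V i \<union> V j)"
    and lin: "linear \<phi>" and pB: "p \<in> span B" and pos: "0 < \<phi> p"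
    and ex: "\<exists>\<sigma>\<in>discrete_join I V. in_conv a \<sigma> p"
    and above: "\<And>\<sigma> v. \<sigma> \<in> discrete_join I V \<Longrightarrow> in_conv a \<sigma> p \<Longrightarrow> v \<in> \<sigma> \<Longrightarrow> \<phi> p \<le> \<phi> (a v)"
    and nearest: "\<And>\<sigma> t. \<sigma> \<in> discrete_join I V \<Longrightarrow> 0 < t \<Longrightarrow> in_conv a \<sigma> (t *\<^sub>R p) \<Longrightarrow> 1 \<le> t"
  shows "\<exists>\<sigma>\<in>discrete_join I V. captures a \<sigma>"
proof (rule ccontr)
  let ?X = "discrete_join I V"
  assume none: "\<not> ?thesis"
  have Xfin: "finite \<sigma>" if "\<sigma> \<in> ?X" for \<sigma> using that by (auto simp: discrete_join_def)
  have Xsub: "\<rho> \<in> ?X" if "\<sigma> \<in> ?X" "\<rho> \<subseteq> \<sigma>" for \<rho> \<sigma>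
    unfolding discrete_join_def
  proof (intro CollectI conjI ballI)
    show "finite \<rho>" using that Xfin finite_subset by blast
    show "\<rho> \<subseteq> (\<Union>i\<in>I. V i)" using that by (auto simp: discrete_join_def)
    fix i assume "i \<in> I"
    then have "card (\<sigma> \<inter> V i) \<le> 1" using that by (auto simp: discrete_join_def)
    moreover have "card (\<rho> \<inter> V i) \<le> card (\<sigma> \<inter> V i)"
      using that Xfin by (intro card_mono) auto
    ultimately show "card (\<rho> \<inter> V i) \<le> 1" by linarith
  qed
  obtain \<sigma> where \<sigma>: "\<sigma> \<in> ?X" "in_conv a \<sigma> p"
    and least: "\<And>\<rho>. \<rho> \<in> ?X \<Longrightarrow> in_conv a \<rho> p \<Longrightarrow> card \<sigma> \<le> card \<rho>"
    using ex_has_least_nat[of "\<lambda>\<sigma>. \<sigma> \<in> ?X \<and> in_conv a \<sigma> p" _ card] ex by blast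
  have minimal: "\<not> in_conv a \<rho> p" if "\<rho> \<subset> \<sigma>" for \<rho>
    using least[of \<rho>] Xsub[OF \<sigma>(1), of \<rho>] psubset_card_mono[OF Xfin[OF \<sigma>(1)] that] that by auto
  obtain c0 where c0: "\<And>v. v \<in> \<sigma> \<Longrightarrow> 0 < c0 v" "(\<Sum>v\<in>\<sigma>. c0 v *\<^sub>R a v) = p"
    and eq: "\<And>v. v \<in> \<sigma> \<Longrightarrow> \<phi> (a v) = \<phi> p"
    and indep: "\<And>n. (\<Sum>v\<in>\<sigma>. n v *\<^sub>R a v) = 0 \<Longrightarrow> \<forall>v\<in>\<sigma>. n v = 0"
    using minimal_conv_independent[OF Xfin[OF \<sigma>(1)] lin pos \<sigma>(2) minimal above[OF \<sigma>]] by blast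
  have aB': "a ` \<rho> \<subseteq> span B" if "\<rho> \<in> ?X" for \<rho>
    using that aB by (auto simp: discrete_join_def)
  have le: "card \<sigma> \<le> card B"
  proof (rule ccontr)
    assume "\<not> card \<sigma> \<le> card B"
    then obtain n where "\<exists>v\<in>\<sigma>. n v \<noteq> 0" "(\<Sum>v\<in>\<sigma>. n v *\<^sub>R a v) = 0"
      using family_dependent[OF Xfin[OF \<sigma>(1)] B(1) _ aB'[OF \<sigma>(1)]] by (metis not_le)
    then show False using indep by blast
  qed
  define J where "J = {i\<in>I. \<sigma> \<inter> V i \<noteq> {}}"
  have J: "finite J" "J \<subseteq> I" using I(1) by (auto simp: J_def)
  define \<alpha> where "\<alpha> j = (SOME v. v \<in> \<sigma> \<inter> V j)" for j
  have \<alpha>: "\<alpha> j \<in> \<sigma>" "\<alpha> j \<in> V j" if "j \<in> J" for j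
    using someI_ex[of "\<lambda>v. v \<in> \<sigma> \<inter> V j"] that by (auto simp: J_def \<alpha>_def)
  have inj: "inj_on g K" if "\<And>j. j \<in> K \<Longrightarrow> g j \<in> V j" "K \<subseteq> I" for g K
  proof (rule inj_onI, rule ccontr)
    fix x y assume xy: "x \<in> K" "y \<in> K" "g x = g y" "x \<noteq> y"
    then have "V x \<inter> V y = {}" using disjoint_family_onD[OF disj, of x y] that(2) by blast
    then show False using that(1)[OF xy(1)] that(1)[OF xy(2)] xy(3) by auto
  qed
  have cardJ: "card J \<le> card \<sigma>"
    using card_inj_on_le[OF inj[of J \<alpha>], of \<sigma>] \<alpha> J Xfin[OF \<sigma>(1)] by blast
  have missing: "\<phi> p \<le> \<phi> (a u)" if i: "i \<in> I - J" and u: "u \<in> V i" for i u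
  proof -
    have "insert u \<sigma> \<in> ?X"
      unfolding discrete_join_def
    proof (intro CollectI conjI ballI)
      show "finite (insert u \<sigma>)" using Xfin \<sigma>(1) by blast
      show "insert u \<sigma> \<subseteq> (\<Union>i\<in>I. V i)" using \<sigma>(1) i u by (auto simp: discrete_join_def)
      fix j assume j: "j \<in> I"
      show "card (insert u \<sigma> \<inter> V j) \<le> 1"
      proof (cases "j = i")
        case True
        then have "insert u \<sigma> \<inter> V j = {u}" using i u by (auto simp: J_def)
        then show ?thesis by simp
      next
        case False
        then have "u \<notin> V j" using disjoint_family_onD[OF disj, of i j] False i j u by blast
        then have "insert u \<sigma> \<inter> V j = \<sigma> \<inter> V j" by auto
        then show ?thesis using \<sigma>(1) j by (auto simp: discrete_join_def)
      qed
    qed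
    then show ?thesis
      by (rule above) (use in_conv_mono[OF \<sigma>(2)] Xfin[OF \<sigma>(1)] in auto)
  qed
  have below: "\<exists>v\<in>V i \<union> V j. \<phi> (a v) < \<phi> p" if ij: "i \<in> I" "j \<in> I" "i \<noteq> j" for i j
  proof -
    obtain v where "v \<in> V i \<union> V j" "\<phi> (a v) \<le> 0"
      using captures_linear_nonpos[OF _ pairs[OF ij] lin] V(1) ij by blast
    then show ?thesis using pos by (intro bexI[of _ v]) auto
  qed
  have "card J < card I" using le cardJ I(2) by simp
  then obtain i where i: "i \<in> I - J" using J(1) card_mono[of J I] by fastforce
  have "I - J = {i}"
  proof (rule ccontr)
    assume "I - J \<noteq> {i}"
    then obtain j where j: "j \<in> I - J" "j \<noteq> i" using i by blast
    then show False using below[of i j] missing[OF i] missing[OF j(1)] i by force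
  qed
  then have Ji: "J = I - {i}" using J(2) by blast
  have cJ: "card J = card B" using I i by (simp add: Ji)
  have c\<sigma>: "card \<sigma> = card B" using le cardJ cJ by simp
  have \<alpha>J: "\<alpha> ` J = \<sigma>"
  proof (rule card_subset_eq)
    show "finite \<sigma>" using Xfin \<sigma>(1) by blast
    show "\<alpha> ` J \<subseteq> \<sigma>" using \<alpha> by blast
    show "card (\<alpha> ` J) = card \<sigma>" using card_image[OF inj[of J \<alpha>]] \<alpha> J(2) cJ c\<sigma> by simp
  qed
  have "\<exists>v. v \<in> V j \<and> \<phi> (a v) < \<phi> p" if "j \<in> J" for j
    using below[of i j] missing[OF i] that i Ji J(2) by (metis DiffE Un_iff insertCI not_le subsetD)
  then obtain \<beta> where \<beta>: "\<And>j. j \<in> J \<Longrightarrow> \<beta> j \<in> V j" "\<And>j. j \<in> J \<Longrightarrow> \<phi> (a (\<beta> j)) < \<phi> p"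
    by metis
  obtain u where u: "u \<in> V i" using V(2) i by blast
  \<comment> \<open>\<open>K\<close> is the set of colours at which a facet of the cross-polytope
    uses \<open>\<beta>\<close> instead of \<open>\<alpha>\<close>; \<open>K = {}\<close> gives
    \<open>\<sigma>\<close>.\<close>
  define \<gamma> where "\<gamma> K j = (if j \<in> K then \<beta> j else \<alpha> j)" for K j
  have \<gamma>: "\<gamma> K j \<in> V j" if "j \<in> J" for K j using \<alpha> \<beta> that by (simp add: \<gamma>_def)
  have inj\<gamma>: "inj_on (\<gamma> K) J" for K using inj[of J "\<gamma> K"] \<gamma> J(2) by blast
  have unot: "u \<notin> \<gamma> K ` J" for K
  proof
    assume "u \<in> \<gamma> K ` J"
    then obtain j where j: "j \<in> J" "u \<in> V j" using \<gamma> by blast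
    then show False using disjoint_family_onD[OF disj, of i j] Ji i u by blast
  qed
  have \<tau>X: "\<gamma> K ` J \<in> ?X" for K
    using discrete_join_image[OF disj J] \<gamma> by blast
  have \<sigma>X: "insert u (\<gamma> K ` J) \<in> ?X" for K
  proof -
    have "(\<gamma> K)(i := u) ` insert i J = insert u (\<gamma> K ` J)"
      using Ji by (auto simp: image_iff)
    moreover have "(\<gamma> K)(i := u) ` insert i J \<in> ?X"
      by (rule discrete_join_image[OF disj]) (use J i u \<gamma> in auto)
    ultimately show ?thesis by simp
  qed
  have card\<tau>: "card (\<gamma> K ` J) = card B" for K using card_image[OF inj\<gamma>] cJ by simp
  \<comment> \<open>The vertices lie at level at most \<open>\<phi> p\<close>, so the coefficient
    sum \<open>s\<close> is at least 1. Scaling \<open>p\<close> by \<open>1 / s\<close> and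
    applying \<open>nearest\<close> gives \<open>s = 1\<close>, which kills the coefficients at the
    vertices \<open>\<beta>\<close>. But the coefficients of \<open>p\<close> over
    \<open>\<sigma>\<close> are unique and positive.\<close>
  have not_cone: "\<not> in_cone a (\<gamma> K ` J) p" if K: "K \<subseteq> J" "K \<noteq> {}" for K
  proof
    assume "in_cone a (\<gamma> K ` J) p"
    then obtain c where c: "\<forall>v\<in>\<gamma> K ` J. 0 \<le> c v" "(\<Sum>v\<in>\<gamma> K ` J. c v *\<^sub>R a v) = p"
      unfolding in_cone_def by blast
    define e where "e j = c (\<gamma> K j)" for j
    have e0: "0 \<le> e j" if "j \<in> J" for j using c(1) that by (simp add: e_def)
    have e: "(\<Sum>j\<in>J. e j *\<^sub>R a (\<gamma> K j)) = p"
      using c(2) by (simp add: sum.reindex[OF inj\<gamma>] e_def)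
    define s where "s = sum e J"
    have s: "s = sum c (\<gamma> K ` J)" by (simp add: s_def sum.reindex[OF inj\<gamma>] e_def)
    have "\<phi> p = (\<Sum>j\<in>J. e j * \<phi> (a (\<gamma> K j)))"
      unfolding e[symmetric] by (rule linear_sum_scaleR[OF lin])
    then have \<phi>p: "s * \<phi> p - \<phi> p = (\<Sum>j\<in>J. e j * (\<phi> p - \<phi> (a (\<gamma> K j))))"
      by (simp add: s_def right_diff_distrib sum_subtractf sum_distrib_right)
    have summand: "0 \<le> e j * (\<phi> p - \<phi> (a (\<gamma> K j)))" if "j \<in> J" for j
      using e0[OF that] \<beta>(2)[OF that] eq[OF \<alpha>(1)[OF that]] by (simp add: \<gamma>_def)
    then have "0 \<le> s * \<phi> p - \<phi> p" unfolding \<phi>p by (rule sum_nonneg)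
    then have s1: "1 \<le> s" using pos by simp
    have "in_conv a (\<gamma> K ` J) ((1 / s) *\<^sub>R p)"
      unfolding in_conv_def
    proof (intro exI[of _ "\<lambda>v. c v / s"] conjI ballI)
      show "0 \<le> c v / s" if "v \<in> \<gamma> K ` J" for v using c(1) s1 that by auto
      show "(\<Sum>v\<in>\<gamma> K ` J. c v / s) = 1" using s s1 by (simp flip: sum_divide_distrib)
      have "(\<Sum>v\<in>\<gamma> K ` J. (c v / s) *\<^sub>R a v) = (1 / s) *\<^sub>R (\<Sum>v\<in>\<gamma> K ` J. c v *\<^sub>R a v)"
        by (simp add: scaleR_sum_right)
      then show "(\<Sum>v\<in>\<gamma> K ` J. (c v / s) *\<^sub>R a v) = (1 / s) *\<^sub>R p" using c(2) by simp
    qed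
    then have "1 \<le> 1 / s" using nearest[OF \<tau>X] s1 by simp
    then have "s = 1" using s1 by (simp add: field_simps)
    then have "\<forall>j\<in>J. e j * (\<phi> p - \<phi> (a (\<gamma> K j))) = 0"
      using \<phi>p sum_nonneg_eq_0_iff[OF J(1), of "\<lambda>j. e j * (\<phi> p - \<phi> (a (\<gamma> K j)))"] summand by simp
    then have eK: "e k = 0" if "k \<in> K" for k
      using \<beta>(2)[of k] that K(1) by (force simp: \<gamma>_def)
    have "(\<Sum>j\<in>J. e j *\<^sub>R a (\<gamma> K j)) = (\<Sum>j\<in>J. e j *\<^sub>R a (\<alpha> j))"
      by (rule sum.cong) (auto simp: \<gamma>_def eK)
    then have "(\<Sum>j\<in>J. e j *\<^sub>R a (\<alpha> j)) = p" using e by simp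
    moreover have inj\<alpha>: "inj_on \<alpha> J" using inj[of J \<alpha>] \<alpha>(2) J(2) by blast
    ultimately have "(\<Sum>v\<in>\<sigma>. (e (inv_into J \<alpha> v) - c0 v) *\<^sub>R a v) = 0"
      using c0(2) unfolding \<alpha>J[symmetric]
      by (simp add: sum.reindex[OF inj\<alpha>] scaleR_left_diff_distrib sum_subtractf)
    from indep[OF this] have z: "\<forall>v\<in>\<sigma>. e (inv_into J \<alpha> v) - c0 v = 0" .
    obtain k where k: "k \<in> K" "k \<in> J" using K by blast
    have "e k = c0 (\<alpha> k)"
      using bspec[OF z \<alpha>(1)[OF k(2)]] inv_into_f_f[OF inj\<alpha> k(2)] by simp
    then show False using eK[OF k(1)] c0(1)[OF \<alpha>(1)[OF k(2)]] by simp
  qed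
  obtain q where q: "q \<in> span B"
    and gen: "\<And>p. \<forall>\<^sub>F t in at_right (0::real). \<forall>\<rho>\<subseteq>(\<Union>i\<in>I. V i). card \<rho> < card B \<longrightarrow> p + t *\<^sub>R q \<notin> span (a ` \<rho>)"
    using exists_generic_direction[of "\<Union>i\<in>I. V i" B a] I(1) V(1) B by blast
  have XU: "\<rho> \<subseteq> (\<Union>i\<in>I. V i)" if "\<rho> \<in> ?X" for \<rho> using that by (auto simp: discrete_join_def)
  have ev1: "\<forall>\<^sub>F t in at_right (0::real). \<forall>K\<in>Pow J - {{}}. \<not> in_cone a (\<gamma> K ` J) (p + t *\<^sub>R q)"
  proof (intro eventually_ball_finite ballI)
    show "finite (Pow J - {{}})" using J(1) by simp
    fix K assume K: "K \<in> Pow J - {{}}"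
    have "\<forall>\<^sub>F t in at_right (0::real). \<forall>\<rho>\<subseteq>\<gamma> K ` J. card \<rho> < card B \<longrightarrow> p + t *\<^sub>R q \<notin> span (a ` \<rho>)"
      using gen[of p] by (rule eventually_mono) (use XU[OF \<tau>X[of K]] subset_trans in metis)
    then show "\<forall>\<^sub>F t in at_right (0::real). \<not> in_cone a (\<gamma> K ` J) (p + t *\<^sub>R q)"
      using not_cone[of K] K J(1)
      by (intro eventually_not_in_cone[OF _ B(1) card\<tau> aB'[OF \<tau>X] pB q]) auto
  qed
  obtain e where e: "(\<Sum>v\<in>\<sigma>. e v *\<^sub>R a v) = q"
    using independent_family_obtain[OF Xfin[OF \<sigma>(1)] B(1) c\<sigma> aB'[OF \<sigma>(1)] q indep] by blast
  have ev2: "\<forall>\<^sub>F t in at_right (0::real). \<forall>v\<in>\<sigma>. 0 < c0 v + t * e v"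
    using c0(1) Xfin[OF \<sigma>(1)] by (intro eventually_ball_finite ballI eventually_at_right_affine_pos) auto
  \<comment> \<open>One small \<open>t\<close> keeps the perturbed point in the cone over
    \<open>\<sigma>\<close>, outside the cones over all other facets of the cross-polytope, and
    generic.\<close>
  obtain t :: real where t: "\<forall>K\<in>Pow J - {{}}. \<not> in_cone a (\<gamma> K ` J) (p + t *\<^sub>R q)"
      "\<forall>v\<in>\<sigma>. 0 < c0 v + t * e v"
      "\<forall>\<rho>\<subseteq>(\<Union>i\<in>I. V i). card \<rho> < card B \<longrightarrow> p + t *\<^sub>R q \<notin> span (a ` \<rho>)"
    using eventually_happens[OF eventually_conj[OF ev1 eventually_conj[OF ev2 gen[of p]]]]
      trivial_limit_at_right_real by blast
  define w where "w = p + t *\<^sub>R q"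
  define f :: "'v set \<Rightarrow> bit" where "f \<tau> = of_bool (in_cone a \<tau> w)" for \<tau>
  have wB: "w \<in> span B" unfolding w_def using pB q by (intro span_add span_scale)
  have "(\<Sum>v\<in>\<sigma>. (c0 v + t * e v) *\<^sub>R a v) = w"
    unfolding w_def c0(2)[symmetric] e[symmetric]
    by (simp add: scaleR_add_left sum.distrib scaleR_sum_right)
  then have "in_cone a \<sigma> w"
    unfolding in_cone_def using t(2) by (intro exI[of _ "\<lambda>v. c0 v + t * e v"]) auto
  moreover have "\<gamma> {} ` J = \<sigma>" unfolding \<alpha>J[symmetric] \<gamma>_def by simp
  ultimately have f1: "f (\<gamma> {} ` J) = 1" by (simp add: f_def)
  have f0: "f (\<gamma> K ` J) = 0" if "K \<in> Pow J - {{}}" for K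
    using t(1) that by (simp add: f_def w_def)
  \<comment> \<open>Each simplex with apex \<open>u\<close> is colourful, so by assumption neither
    it nor a face of it captures, and the parity of its facets is 0.\<close>
  have facets: "(\<Sum>v\<in>insert u (\<gamma> K ` J). f (insert u (\<gamma> K ` J) - {v})) = 0" for K
  proof -
    let ?\<sigma> = "insert u (\<gamma> K ` J)"
    have "(\<Sum>v\<in>?\<sigma>. f (?\<sigma> - {v})) = of_bool (captures a ?\<sigma>)"
      unfolding f_def
    proof (rule sum_cone_facets_eq_captures[OF _ B(1) _ aB'[OF \<sigma>X] wB])
      show "finite ?\<sigma>" using J(1) by simp
      show "card ?\<sigma> = Suc (card B)" using J(1) unot card\<tau> by simp
      show "w \<notin> span (a ` \<rho>)" if "\<rho> \<subseteq> ?\<sigma>" "card \<rho> < card B" for \<rho>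
        using t(3) that XU[OF \<sigma>X[of K]] unfolding w_def by blast
      show "\<not> captures a \<rho>" if "\<rho> \<subset> ?\<sigma>" for \<rho>
        using none Xsub[OF \<sigma>X[of K]] that by blast
    qed
    also have "captures a ?\<sigma> = False" using none \<sigma>X by blast
    finally show ?thesis by simp
  qed
  have split: "(\<Sum>v\<in>insert u (\<gamma> K ` J). f (insert u (\<gamma> K ` J) - {v})) =
      f (\<gamma> K ` J) + (\<Sum>j\<in>J. f (insert u (\<gamma> K ` (J - {j}))))" for K
  proof -
    have "insert u (\<gamma> K ` J) - {\<gamma> K j} = insert u (\<gamma> K ` (J - {j}))" if "j \<in> J" for j
      using inj\<gamma>[of K] unot[of K] that by (auto simp: inj_on_def)
    then have "(\<Sum>v\<in>\<gamma> K ` J. f (insert u (\<gamma> K ` J) - {v})) = (\<Sum>j\<in>J. f (insert u (\<gamma> K ` (J - {j}))))"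
      by (simp add: sum.reindex[OF inj\<gamma>])
    then show ?thesis using unot[of K] J(1) by simp
  qed
  \<comment> \<open>Summed over all \<open>K\<close>, a facet that contains \<open>u\<close> and
    omits colour \<open>j\<close> arises from sets \<open>K\<close> with and without
    \<open>j\<close> and cancels. The facets of the cross-polytope remain, and \<open>w\<close> hits
    only \<open>\<sigma>\<close>.\<close>
  have "0 = (\<Sum>K\<in>Pow J. f (\<gamma> K ` J)) + (\<Sum>K\<in>Pow J. \<Sum>j\<in>J. f (insert u (\<gamma> K ` (J - {j}))))"
    using facets unfolding split sum.distrib[symmetric] by (intro sum.neutral[symmetric] ballI)
  also have "(\<Sum>K\<in>Pow J. \<Sum>j\<in>J. f (insert u (\<gamma> K ` (J - {j})))) =
      (\<Sum>j\<in>J. \<Sum>K\<in>Pow J. f (insert u (\<gamma> K ` (J - {j}))))"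
    by (rule sum.swap)
  also have "\<dots> = 0"
  proof (rule sum.neutral, rule ballI)
    fix j assume j: "j \<in> J"
    have "\<gamma> (insert j K) ` (J - {j}) = \<gamma> K ` (J - {j})" for K
      by (rule image_cong) (auto simp: \<gamma>_def)
    then show "(\<Sum>K\<in>Pow J. f (insert u (\<gamma> K ` (J - {j})))) = 0"
      by (intro sum_Pow_toggle_bit[OF J(1) j]) simp
  qed
  also have "(\<Sum>K\<in>Pow J. f (\<gamma> K ` J)) = (\<Sum>K\<in>{{}}. f (\<gamma> K ` J))"
    by (rule sum.mono_neutral_right) (use J(1) f0 in auto)
  finally show False using f1 by simp
qed

section \<open>Coordinate spaces and open simplices\<close>

lemma lookup_scaleR_real:
  fixes x :: "'i \<Rightarrow>\<^sub>0 real"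
  shows "Poly_Mapping.lookup (r *\<^sub>R x) i = r * Poly_Mapping.lookup x i"
proof -
  have "finite {i. r *\<^sub>R Poly_Mapping.lookup x i \<noteq> 0}"
    by (rule finite_subset[OF _ finite_lookup[of x]]) auto
  then show ?thesis by (simp add: scaleR_poly_mapping_def Abs_poly_mapping_inverse)
qed

text \<open>The norm of this type is the sum of the absolute values of the coordinates. Continuity
  of coordinates later makes positivity an open condition and the squared length continuous.\<close>

lemma bounded_linear_lookup: "bounded_linear (\<lambda>x :: 'i \<Rightarrow>\<^sub>0 real. Poly_Mapping.lookup x i)"
proof (rule bounded_linear_intro[where K = 1])
  fix x :: "'i \<Rightarrow>\<^sub>0 real"
  have "norm (Poly_Mapping.lookup x i) \<le> (\<Sum>n\<in>Poly_Mapping.keys x. norm (Poly_Mapping.lookup x n))"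
  proof (cases "i \<in> Poly_Mapping.keys x")
    case True
    then show ?thesis by (intro member_le_sum) auto
  next
    case False
    then show ?thesis by (auto simp: in_keys_iff intro: sum_nonneg)
  qed
  also have "\<dots> = norm x" by (simp add: norm_poly_mapping_def dist_poly_mapping_def)
  finally show "norm (Poly_Mapping.lookup x i) \<le> norm x * 1" by simp
qed (auto simp: lookup_add lookup_scaleR_real)

lemmas continuous_on_lookup [continuous_intros] =
  bounded_linear.continuous_on[OF bounded_linear_lookup]

lemma lookup_sum_basis:
  assumes "finite \<sigma>"
  shows "Poly_Mapping.lookup (\<Sum>v\<in>\<sigma>. c v *\<^sub>R basis_vec v) k = (if k \<in> \<sigma> then c k else (0::real))"
proof -
  have "Poly_Mapping.lookup (\<Sum>v\<in>\<sigma>. c v *\<^sub>R basis_vec v) k = (\<Sum>v\<in>\<sigma>. if v = k then c v else 0)"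
    unfolding lookup_sum
    by (rule sum.cong) (auto simp: lookup_scaleR_real lookup_single when_def)
  also have "\<dots> = (if k \<in> \<sigma> then c k else 0)"
    using assms by simp
  finally show ?thesis .
qed

lemma inj_basis_vec: "inj_on (basis_vec :: 'v \<Rightarrow> 'v \<Rightarrow>\<^sub>0 real) S"
  by (auto simp: inj_on_def dest: arg_cong[where f = Poly_Mapping.keys])

lemma sum_basis_image:
  "(\<Sum>x\<in>basis_vec ` \<sigma>. u x *\<^sub>R x) = (\<Sum>v\<in>\<sigma>. u (basis_vec v) *\<^sub>R (basis_vec v :: 'v \<Rightarrow>\<^sub>0 real))"
  by (simp add: sum.reindex[OF inj_basis_vec])

lemma independent_basis_vec:
  assumes "finite S"
  shows "independent (basis_vec ` S :: ('v \<Rightarrow>\<^sub>0 real) set)"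
proof
  assume "dependent (basis_vec ` S :: ('v \<Rightarrow>\<^sub>0 real) set)"
  then obtain u where u: "\<exists>v\<in>S. u (basis_vec v :: 'v \<Rightarrow>\<^sub>0 real) \<noteq> 0"
      "(\<Sum>v\<in>S. u (basis_vec v) *\<^sub>R (basis_vec v :: 'v \<Rightarrow>\<^sub>0 real)) = 0"
    using assms by (auto simp: dependent_finite sum_basis_image)
  have "u (basis_vec k) = 0" if "k \<in> S" for k
    using arg_cong[OF u(2), of "\<lambda>x. Poly_Mapping.lookup x k"] that
    by (simp add: lookup_sum_basis[OF assms])
  then show False using u(1) by blast
qed

lemma coord_space_subset_span:
  assumes "finite J"
  shows "coord_space J \<subseteq> span (basis_vec ` J)"
proof
  fix x assume "x \<in> coord_space J"
  then have x: "Poly_Mapping.keys x \<subseteq> J" by (simp add: coord_space_def)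
  have "x = (\<Sum>v\<in>J. Poly_Mapping.lookup x v *\<^sub>R basis_vec v)"
    by (rule poly_mapping_eqI) (use x in \<open>auto simp: lookup_sum_basis[OF assms] in_keys_iff\<close>)
  then show "x \<in> span (basis_vec ` J)" using sum_scaleR_in_span by metis
qed

lemma convex_coord_space: "convex (coord_space J)"
proof (rule convexI)
  fix x y :: "'a \<Rightarrow>\<^sub>0 real" and s t :: real
  assume xy: "x \<in> coord_space J" "y \<in> coord_space J"
  have "i \<in> J" if "Poly_Mapping.lookup (s *\<^sub>R x + t *\<^sub>R y) i \<noteq> 0" for i
  proof (rule ccontr)
    assume "i \<notin> J"
    then have "Poly_Mapping.lookup x i = 0" "Poly_Mapping.lookup y i = 0"
      using xy by (auto simp: coord_space_def in_keys_iff)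
    then show False using that by (simp add: lookup_add lookup_scaleR_real)
  qed
  then show "s *\<^sub>R x + t *\<^sub>R y \<in> coord_space J"
    unfolding coord_space_def by (auto simp: in_keys_iff)
qed

text \<open>Positivity of the coordinates in \<open>\<sigma>\<close> defines an open set whose
  intersection with the affine hull already lies in the convex hull.\<close>

lemma open_simplexI:
  assumes "finite \<sigma>" "\<And>v. v \<in> \<sigma> \<Longrightarrow> 0 < c v" "sum c \<sigma> = 1"
  shows "(\<Sum>v\<in>\<sigma>. c v *\<^sub>R basis_vec v) \<in> open_simplex \<sigma>"
proof -
  let ?x = "\<Sum>v\<in>\<sigma>. c v *\<^sub>R (basis_vec v :: 'a \<Rightarrow>\<^sub>0 real)"
  define T where "T = (\<Inter>v\<in>\<sigma>. {y :: 'a \<Rightarrow>\<^sub>0 real. 0 < Poly_Mapping.lookup y v})"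
  have "open T"
    unfolding T_def
    by (intro open_INT ballI open_Collect_less continuous_intros assms(1))
  have hull: "T \<inter> affine hull (basis_vec ` \<sigma>) \<subseteq> convex hull (basis_vec ` \<sigma>)"
  proof
    fix y :: "'a \<Rightarrow>\<^sub>0 real" assume y: "y \<in> T \<inter> affine hull (basis_vec ` \<sigma>)"
    then obtain u where u: "sum u (basis_vec ` \<sigma>) = 1" "(\<Sum>x\<in>basis_vec ` \<sigma>. u x *\<^sub>R x) = y"
      using assms(1) by (auto simp: affine_hull_finite)
    have "0 \<le> u (basis_vec v)" if v: "v \<in> \<sigma>" for v
    proof -
      have "Poly_Mapping.lookup y v = u (basis_vec v)"
        unfolding u(2)[symmetric] sum_basis_image lookup_sum_basis[OF assms(1)] using v by simp
      then show ?thesis using y v by (auto simp: T_def)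
    qed
    then show "y \<in> convex hull (basis_vec ` \<sigma>)"
      using u assms(1) by (auto simp: convex_hull_finite)
  qed
  have "?x \<in> T"
    by (auto simp: T_def lookup_sum_basis[OF assms(1)] assms(2))
  moreover have "?x \<in> convex hull (basis_vec ` \<sigma>)"
    by (rule convex_sum) (use assms in \<open>auto simp: convex_convex_hull hull_inc less_imp_le\<close>)
  ultimately have "\<exists>T. open T \<and> ?x \<in> T \<inter> convex hull (basis_vec ` \<sigma>) \<and>
      T \<inter> affine hull (convex hull (basis_vec ` \<sigma>)) \<subseteq> convex hull (basis_vec ` \<sigma>)"
    using \<open>open T\<close> hull by (intro exI[of _ T]) simp
  then show ?thesis
    unfolding open_simplex_def closed_simplex_def mem_rel_interior .
qed

lemma captures_if_face_image:
  assumes A: "affine_map_on K A" "\<sigma> \<in> K" and fin: "finite \<sigma>" and zero: "0 \<in> face_image A \<sigma>"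
  shows "captures (\<lambda>v. A (basis_vec v)) \<sigma>"
proof -
  obtain x where x: "x \<in> open_simplex \<sigma>" "A x = 0"
    using zero by (auto simp: face_image_def)
  have "x \<in> convex hull (basis_vec ` \<sigma>)"
    using x(1) rel_interior_subset unfolding open_simplex_def closed_simplex_def by blast
  then obtain u where u: "\<And>v. v \<in> \<sigma> \<Longrightarrow> 0 \<le> u (basis_vec v)" "sum u (basis_vec ` \<sigma>) = 1"
      "(\<Sum>x\<in>basis_vec ` \<sigma>. u x *\<^sub>R x) = x"
    using fin by (auto simp: convex_hull_finite)
  define c where "c v = u (basis_vec v)" for v
  have c: "sum c \<sigma> = 1" using u(2) by (simp add: sum.reindex[OF inj_basis_vec] c_def)
  have "(\<forall>v\<in>\<sigma>. 0 \<le> c v) \<and> sum c \<sigma> = 1" using u(1) c by (simp add: c_def)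
  then have "A (\<Sum>v\<in>\<sigma>. c v *\<^sub>R basis_vec v) = (\<Sum>v\<in>\<sigma>. c v *\<^sub>R A (basis_vec v))"
    using A unfolding affine_map_on_def by simp
  then have "(\<Sum>v\<in>\<sigma>. c v *\<^sub>R A (basis_vec v)) = 0"
    using u(3) x(2) by (simp add: sum_basis_image c_def)
  moreover have "\<exists>v\<in>\<sigma>. c v \<noteq> 0" using c by (metis sum.neutral zero_neq_one)
  ultimately show ?thesis unfolding captures_def using u(1) by (intro exI[of _ c]) (auto simp: c_def)
qed

text \<open>The combination may be a boundary point of the simplex, so the face to take is the
  support of the coefficients: there they are positive and, once normalised, give a point of the
  open simplex.\<close>

lemma face_image_if_captures:
  assumes A: "affine_map_on (full_simplex U) A" and \<sigma>: "\<sigma> \<subseteq> U" "finite \<sigma>"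
    and cap: "captures (\<lambda>v. A (basis_vec v)) \<sigma>"
  obtains \<tau> where "\<tau> \<subseteq> \<sigma>" "0 \<in> face_image A \<tau>"
proof -
  obtain c where c: "\<forall>v\<in>\<sigma>. 0 \<le> c v" "\<exists>v\<in>\<sigma>. c v \<noteq> 0" "(\<Sum>v\<in>\<sigma>. c v *\<^sub>R A (basis_vec v)) = 0"
    using cap unfolding captures_def by blast
  define \<tau> where "\<tau> = {v\<in>\<sigma>. c v \<noteq> 0}"
  define s where "s = sum c \<tau>"
  have \<tau>: "\<tau> \<subseteq> \<sigma>" "finite \<tau>" "\<tau> \<noteq> {}" "\<And>v. v \<in> \<tau> \<Longrightarrow> 0 < c v"
    using c(1,2) \<sigma>(2) by (auto simp: \<tau>_def order_less_le)
  have s: "0 < s" unfolding s_def using \<tau> by (intro sum_pos) auto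
  define e where "e v = c v / s" for v
  have e: "0 < e v" if "v \<in> \<tau>" for v using \<tau>(4)[OF that] s by (simp add: e_def)
  have e1: "sum e \<tau> = 1" using s by (simp add: e_def s_def flip: sum_divide_distrib)
  have "(\<Sum>v\<in>\<tau>. c v *\<^sub>R A (basis_vec v)) = (\<Sum>v\<in>\<sigma>. c v *\<^sub>R A (basis_vec v))"
    by (rule sum_scaleR_mono_neutral[symmetric]) (use \<sigma> in \<open>auto simp: \<tau>_def\<close>)
  then have "(\<Sum>v\<in>\<tau>. c v *\<^sub>R A (basis_vec v)) = 0" using c(3) by simp
  then have "(1 / s) *\<^sub>R (\<Sum>v\<in>\<tau>. c v *\<^sub>R A (basis_vec v)) = 0" by simp
  then have z: "(\<Sum>v\<in>\<tau>. e v *\<^sub>R A (basis_vec v)) = 0"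
    by (simp add: scaleR_sum_right e_def)
  have "\<tau> \<in> full_simplex U" using \<tau>(1) \<sigma>(1) by (auto simp: full_simplex_def)
  moreover have "(\<forall>v\<in>\<tau>. 0 \<le> e v) \<and> sum e \<tau> = 1" using e e1 by (simp add: less_imp_le)
  ultimately have "A (\<Sum>v\<in>\<tau>. e v *\<^sub>R basis_vec v) = 0"
    using A z unfolding affine_map_on_def by simp
  then have "0 \<in> face_image A \<tau>"
    unfolding face_image_def using open_simplexI[OF \<tau>(2) e e1] by (metis image_eqI)
  then show ?thesis using that \<tau>(1) by blast
qed

section \<open>The nearest point\<close>

text \<open>\<open>a\<close> may send several vertices to one vector, so coefficients cannot simply
  be reindexed over the image; convexity of the set of vertex combinations is used instead.\<close>

lemma in_conv_iff_convex_hull: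
  assumes "finite \<sigma>"
  shows "in_conv a \<sigma> x \<longleftrightarrow> x \<in> convex hull (a ` \<sigma>)"
proof
  assume "in_conv a \<sigma> x"
  then obtain c where "\<forall>v\<in>\<sigma>. 0 \<le> c v" "sum c \<sigma> = 1" "(\<Sum>v\<in>\<sigma>. c v *\<^sub>R a v) = x"
    unfolding in_conv_def by blast
  then show "x \<in> convex hull (a ` \<sigma>)"
    using convex_sum[OF assms convex_convex_hull, of c a "a ` \<sigma>"] by (auto simp: hull_inc)
next
  have "convex {x. in_conv a \<sigma> x}"
  proof (rule convexI)
    fix x y and s t :: real
    assume xy: "x \<in> {x. in_conv a \<sigma> x}" "y \<in> {x. in_conv a \<sigma> x}" and st: "0 \<le> s" "0 \<le> t" "s + t = 1"
    obtain c where c: "\<forall>v\<in>\<sigma>. 0 \<le> c v" "sum c \<sigma> = 1" "(\<Sum>v\<in>\<sigma>. c v *\<^sub>R a v) = x"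
      using xy(1) unfolding in_conv_def by blast
    obtain e where e: "\<forall>v\<in>\<sigma>. 0 \<le> e v" "sum e \<sigma> = 1" "(\<Sum>v\<in>\<sigma>. e v *\<^sub>R a v) = y"
      using xy(2) unfolding in_conv_def by blast
    have "sum (\<lambda>v. s * c v + t * e v) \<sigma> = 1"
      using c(2) e(2) st(3) by (simp add: sum.distrib flip: sum_distrib_left)
    moreover have "(\<Sum>v\<in>\<sigma>. (s * c v + t * e v) *\<^sub>R a v) = s *\<^sub>R x + t *\<^sub>R y"
      unfolding c(3)[symmetric] e(3)[symmetric]
      by (simp add: scaleR_add_left sum.distrib scaleR_sum_right)
    ultimately show "s *\<^sub>R x + t *\<^sub>R y \<in> {x. in_conv a \<sigma> x}"
      unfolding in_conv_def using c(1) e(1) st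
      by (intro CollectI exI[of _ "\<lambda>v. s * c v + t * e v"]) auto
  qed
  moreover have "a ` \<sigma> \<subseteq> {x. in_conv a \<sigma> x}"
  proof clarify
    fix k assume k: "k \<in> \<sigma>"
    have "in_conv a {k} (a k)"
      unfolding in_conv_def by (rule exI[of _ "\<lambda>_. 1"]) simp
    then show "in_conv a \<sigma> (a k)" by (rule in_conv_mono) (use k assms in auto)
  qed
  ultimately have "convex hull (a ` \<sigma>) \<subseteq> {x. in_conv a \<sigma> x}" by (rule hull_minimal[rotated])
  then show "x \<in> convex hull (a ` \<sigma>) \<Longrightarrow> in_conv a \<sigma> x" by blast
qed

lemma in_conv_zero_captures: "in_conv a \<sigma> 0 \<Longrightarrow> captures a \<sigma>"
  unfolding in_conv_def captures_def by (metis sum.neutral zero_neq_one)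

text \<open>The Euclidean inner product of the first \<open>d\<close> coordinates: positive definite
  on \<open>real_space d\<close> but not on the whole type, whose norm does not come from
  it.\<close>

definition inner_upto :: "nat \<Rightarrow> (nat \<Rightarrow>\<^sub>0 real) \<Rightarrow> (nat \<Rightarrow>\<^sub>0 real) \<Rightarrow> real" where
  "inner_upto d x y = (\<Sum>i<d. Poly_Mapping.lookup x i * Poly_Mapping.lookup y i)"

lemma inner_upto_simps:
  "inner_upto d (x + y) z = inner_upto d x z + inner_upto d y z"
  "inner_upto d x (y + z) = inner_upto d x y + inner_upto d x z"
  "inner_upto d (r *\<^sub>R x) z = r * inner_upto d x z"
  "inner_upto d x (r *\<^sub>R z) = r * inner_upto d x z"
  "inner_upto d (x - y) z = inner_upto d x z - inner_upto d y z"
  "inner_upto d x (y - z) = inner_upto d x y - inner_upto d x z"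
  by (simp_all add: inner_upto_def lookup_add lookup_minus lookup_scaleR_real algebra_simps
      sum.distrib sum_subtractf sum_distrib_left)

lemma inner_upto_commute: "inner_upto d x y = inner_upto d y x"
  by (simp add: inner_upto_def mult.commute)

lemma inner_upto_nonneg: "0 \<le> inner_upto d x x"
  by (simp add: inner_upto_def sum_nonneg)

lemma inner_upto_pos:
  assumes "x \<in> real_space d" "x \<noteq> 0"
  shows "0 < inner_upto d x x"
proof -
  obtain i where i: "i \<in> Poly_Mapping.keys x" using assms(2) by (metis ex_in_conv keys_eq_empty)
  then have "i < d" "Poly_Mapping.lookup x i \<noteq> 0"
    using assms(1) by (auto simp: coord_space_def in_keys_iff)
  then show ?thesis
    unfolding inner_upto_def
    by (intro sum_pos2[of _ i]) (auto simp: not_sum_power2_lt_zero zero_less_mult_iff)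
qed

text \<open>First variation of the squared length: a step \<open>t\<close> from \<open>p\<close>
  towards \<open>x\<close> changes it by \<open>t * t * M - 2 * t * \<delta>\<close>, which is
  negative for small \<open>t\<close> if \<open>\<delta> > 0\<close>.\<close>

lemma convex_nearest_halfspace:
  assumes "convex S" "p \<in> S" "x \<in> S" and min: "\<And>y. y \<in> S \<Longrightarrow> inner_upto d p p \<le> inner_upto d y y"
  shows "inner_upto d p p \<le> inner_upto d p x"
proof (rule ccontr)
  assume contra: "\<not> ?thesis"
  define \<delta> where "\<delta> = inner_upto d p p - inner_upto d p x"
  define M where "M = inner_upto d (x - p) (x - p)"
  \<comment> \<open>The bound 1 keeps the point on the segment; \<open>M + 1\<close> avoids division
    by 0 and still yields \<open>t * M \<le> \<delta>\<close>.\<close>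
  define t where "t = min 1 (\<delta> / (M + 1))"
  have \<delta>: "0 < \<delta>" using contra by (simp add: \<delta>_def)
  have M: "0 \<le> M" by (simp add: M_def inner_upto_nonneg)
  have t: "0 < t" "t \<le> 1" using \<delta> M by (auto simp: t_def)
  have "t * M \<le> \<delta> / (M + 1) * M" using M by (intro mult_right_mono) (auto simp: t_def)
  also have "\<dots> \<le> \<delta>" using \<delta> M by (simp add: field_simps)
  finally have tM: "t * M \<le> \<delta>" .
  have "(1 - t) *\<^sub>R p + t *\<^sub>R x \<in> S"
    using assms(1-3) t by (intro convexD) auto
  moreover have "(1 - t) *\<^sub>R p + t *\<^sub>R x = p + t *\<^sub>R (x - p)"
    by (simp add: scaleR_left_diff_distrib scaleR_right_diff_distrib)
  ultimately have "inner_upto d p p \<le> inner_upto d (p + t *\<^sub>R (x - p)) (p + t *\<^sub>R (x - p))"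
    using min by simp
  also have "\<dots> = inner_upto d p p + 2 * t * inner_upto d p (x - p) + t * (t * M)"
    unfolding M_def inner_upto_simps(1-4)
    using inner_upto_commute[of d "x - p" p] by (simp add: algebra_simps)
  also have "inner_upto d p (x - p) = - \<delta>" by (simp add: \<delta>_def inner_upto_simps)
  finally have "2 * (t * \<delta>) \<le> t * (t * M)" by simp
  also have "\<dots> \<le> t * \<delta>" using tM t by (intro mult_left_mono) auto
  finally show False using t \<delta> by simp
qed

lemma finite_discrete_join:
  assumes "finite I" "\<And>i. i \<in> I \<Longrightarrow> finite (V i)"
  shows "finite (discrete_join I V)"
  by (rule finite_subset[of _ "Pow (\<Union>i\<in>I. V i)"]) (use assms in \<open>auto simp: discrete_join_def\<close>)

text \<open>The union of the colourful simplices is compact, so it has a point \<open>p\<close>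
  nearest to 0. Either \<open>p = 0\<close>, or the inner product with \<open>p\<close> supplies the
  functional \<open>\<phi>\<close>. For \<open>d = 0\<close> there are no pairs, but then
  \<open>p = 0\<close> because all images are 0.\<close>

lemma colourful_caratheodory:
  fixes a :: "'v \<Rightarrow> (nat \<Rightarrow>\<^sub>0 real)" and V :: "'i \<Rightarrow> 'v set"
  assumes I: "finite I" "card I = Suc d"
    and V: "\<And>i. i \<in> I \<Longrightarrow> finite (V i)" "\<And>i. i \<in> I \<Longrightarrow> V i \<noteq> {}" and disj: "disjoint_family_on V I"
    and a: "\<And>i v. i \<in> I \<Longrightarrow> v \<in> V i \<Longrightarrow> a v \<in> real_space d"
    and pairs: "\<And>i j. i \<in> I \<Longrightarrow> j \<in> I \<Longrightarrow> i \<noteq> j \<Longrightarrow> captures a (V i \<union> V j)"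
  shows "\<exists>\<sigma>\<in>discrete_join I V. captures a \<sigma>"
proof -
  let ?X = "discrete_join I V" and ?ip = "inner_upto d"
  let ?B = "basis_vec ` {..<d} :: (nat \<Rightarrow>\<^sub>0 real) set"
  define S where "S = (\<Union>\<sigma>\<in>?X. convex hull (a ` \<sigma>))"
  have Xfin: "finite \<sigma>" if "\<sigma> \<in> ?X" for \<sigma> using that by (auto simp: discrete_join_def)
  have conv: "in_conv a \<sigma> x \<longleftrightarrow> x \<in> convex hull (a ` \<sigma>)" if "\<sigma> \<in> ?X" for \<sigma> x
    using in_conv_iff_convex_hull[OF Xfin[OF that]] .
  have "compact S"
    unfolding S_def using finite_discrete_join[OF I(1) V(1)] Xfin
    by (intro compact_UN finite_imp_compact_convex_hull) auto
  moreover have "S \<noteq> {}"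
  proof -
    obtain i where i: "i \<in> I" using I by fastforce
    obtain v where v: "v \<in> V i" using V(2)[OF i] by blast
    have "{v} \<in> ?X" using discrete_join_image[OF disj, of "{i}" "\<lambda>_. v"] i v by simp
    then have "a v \<in> S" unfolding S_def by (intro UN_I[of "{v}"]) auto
    then show ?thesis by blast
  qed
  moreover have "continuous_on S (\<lambda>x. ?ip x x)"
    unfolding inner_upto_def by (intro continuous_intros)
  ultimately have "\<exists>p\<in>S. \<forall>x\<in>S. ?ip p p \<le> ?ip x x" by (rule continuous_attains_inf)
  then obtain p where p: "p \<in> S" "\<And>x. x \<in> S \<Longrightarrow> ?ip p p \<le> ?ip x x" by blast
  then obtain \<sigma> where \<sigma>: "\<sigma> \<in> ?X" "p \<in> convex hull (a ` \<sigma>)" unfolding S_def by blast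
  show ?thesis
  proof (cases "p = 0")
    case True
    then show ?thesis using \<sigma> conv in_conv_zero_captures by blast
  next
    case False
    have aX: "a ` \<rho> \<subseteq> real_space d" if "\<rho> \<in> ?X" for \<rho>
      using that a by (auto simp: discrete_join_def)
    have "p \<in> real_space d"
      using hull_minimal[where S = convex, OF aX[OF \<sigma>(1)] convex_coord_space] \<sigma>(2) by blast
    note pp = inner_upto_pos[OF this False]
    have B: "finite ?B" "independent ?B" "card ?B = d"
      using independent_basis_vec[of "{..<d}"] by (auto simp: card_image[OF inj_basis_vec])
    note sp = coord_space_subset_span[of "{..<d}"]
    show ?thesis
    proof (rule colourful_caratheodory_from_nearest[where B = ?B and p = p and \<phi> = "?ip p"])
      show "linear (?ip p)" by (rule linearI) (auto simp: inner_upto_simps)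
      show "p \<in> span ?B" using sp \<open>p \<in> real_space d\<close> by auto
      show "a v \<in> span ?B" if "i \<in> I" "v \<in> V i" for i v using sp a[OF that] by auto
      show "card I = Suc (card ?B)" using I B by simp
      show "\<exists>\<sigma>\<in>?X. in_conv a \<sigma> p" using \<sigma> conv by blast
      show "?ip p p \<le> ?ip p (a v)" if "\<rho> \<in> ?X" "in_conv a \<rho> p" "v \<in> \<rho>" for \<rho> v
      proof (rule convex_nearest_halfspace[of "convex hull (a ` \<rho>)"])
        show "p \<in> convex hull (a ` \<rho>)" using conv that by blast
        show "a v \<in> convex hull (a ` \<rho>)" using that by (intro hull_inc) auto
        show "?ip p p \<le> ?ip y y" if "y \<in> convex hull (a ` \<rho>)" for y
          using that \<open>\<rho> \<in> ?X\<close> by (intro p(2)) (auto simp: S_def)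
      qed (rule convex_convex_hull)
      show "1 \<le> t" if "\<rho> \<in> ?X" "0 < t" "in_conv a \<rho> (t *\<^sub>R p)" for \<rho> t
      proof -
        have "t *\<^sub>R p \<in> S" using that conv by (auto simp: S_def)
        then have "?ip p p \<le> t * t * ?ip p p" using p(2) by (force simp: inner_upto_simps)
        then have "1 \<le> t * t" using pp by simp
        then show ?thesis using that(2) mult_strict_mono[of t 1 t 1] by force
      qed
    qed (use I V disj pairs B pp in auto)
  qed
qed

section \<open>Cycles through a facet outside the spanning tree\<close>

lemma boundary2_zero [simp]: "boundary2 0 = 0"
  by (simp add: boundary2_def)

text \<open>With no faces of dimension above \<open>k\<close> the only boundary is 0, so homology
  consists of the cycles, wrapped as singleton cosets.\<close>

lemma trivial_reduced_homology2_iff: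
  assumes top: "\<forall>\<tau>\<in>K. face_dim \<tau> \<le> k"
  shows "trivial_group (reduced_homology2 k K) \<longleftrightarrow>
         (\<forall>z. Poly_Mapping.keys z \<subseteq> {\<sigma>\<in>K. face_dim \<sigma> = k} \<and> boundary2 z = 0 \<longrightarrow> z = 0)"
    (is "_ \<longleftrightarrow> ?R")
proof -
  let ?Z = "{z. Poly_Mapping.keys z \<subseteq> {\<sigma>\<in>K. face_dim \<sigma> = k} \<and> boundary2 z = 0}"
  have none: "{\<sigma>\<in>K. face_dim \<sigma> = k + 1} = {}" using top by fastforce
  have B: "boundary2 ` carrier (chain_group2 (k + 1) K) = {0}"
    by (simp add: chain_group2_def none)
  have H: "reduced_homology2 k K =
      \<lparr>carrier = (\<Union>z\<in>?Z. {{z}}), monoid.mult = (\<lambda>A B. \<Union>x\<in>A. \<Union>y\<in>B. {x + y}), one = {0}\<rparr>"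
    unfolding reduced_homology2_def B FactGroup_def RCOSETS_def r_coset_def set_mult_def
    by (simp add: cycle_group2_def chain_group2_def kernel_def)
  \<comment> \<open>\<open>trivial_group\<close> also demands the group laws, but these matter only
    when the carrier is one point, that is, under \<open>?R\<close>.\<close>
  have group: "group (reduced_homology2 k K)" if ?R
  proof -
    have "?Z = {0}" using that by auto
    then have "reduced_homology2 k K =
      \<lparr>carrier = {{0}}, monoid.mult = (\<lambda>A B. \<Union>x\<in>A. \<Union>y\<in>B. {x + y}), one = {0}\<rparr>"
      unfolding H by simp
    then show ?thesis by (auto intro!: groupI)
  qed
  have "carrier (reduced_homology2 k K) = {one (reduced_homology2 k K)} \<longleftrightarrow> ?R"
    unfolding H by auto
  then show ?thesis using group unfolding trivial_group_def by blast
qed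

text \<open>Adding \<open>\<sigma>\<close> creates a nonzero cycle while \<open>T\<close> alone has
  none, so that cycle must pass through \<open>\<sigma>\<close>.\<close>

lemma spanning_tree_fundamental_cycle:
  assumes tree: "Z2_spanning_tree k X T" and \<sigma>: "facet X \<sigma>" "\<sigma> \<notin> T"
  obtains z where "Poly_Mapping.keys z \<subseteq> {\<tau>\<in>insert \<sigma> T. face_dim \<tau> = int k}" "boundary2 z = 0"
    "\<sigma> \<in> Poly_Mapping.keys z"
proof -
  have "finite X" "complex_dim X = int k" and TX: "T \<subseteq> X" and "\<sigma> \<in> X"
    using tree \<sigma> by (auto simp: Z2_spanning_tree_def facet_def)
  then have dim: "face_dim \<tau> \<le> int k" if "\<tau> \<in> X" for \<tau>
    using that Max_ge[of "face_dim ` X" "face_dim \<tau>"] by (simp add: complex_dim_def)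
  have T: "trivial_group (reduced_homology2 (int k) T)"
    and nT: "\<not> trivial_group (reduced_homology2 (int k) (T \<union> {\<sigma>}))"
    using tree \<sigma> by (auto simp: Z2_spanning_tree_def)
  have dim_T\<sigma>: "\<forall>\<tau>\<in>T \<union> {\<sigma>}. face_dim \<tau> \<le> int k" and dim_T: "\<forall>\<tau>\<in>T. face_dim \<tau> \<le> int k"
    using dim TX \<open>\<sigma> \<in> X\<close> by blast+
  obtain z where z: "Poly_Mapping.keys z \<subseteq> {\<tau>\<in>T \<union> {\<sigma>}. face_dim \<tau> = int k}" "boundary2 z = 0" "z \<noteq> 0"
    using nT unfolding trivial_reduced_homology2_iff[OF dim_T\<sigma>] by blast
  have "\<sigma> \<in> Poly_Mapping.keys z"
  proof (rule ccontr)
    assume "\<sigma> \<notin> Poly_Mapping.keys z"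
    then have "Poly_Mapping.keys z \<subseteq> {\<tau>\<in>T. face_dim \<tau> = int k}" using z(1) by blast
    then show False
      using T z(2,3) unfolding trivial_reduced_homology2_iff[OF dim_T] by blast
  qed
  then show ?thesis using that z(1,2) by simp
qed

text \<open>The sum is the coboundary of \<open>f\<close> evaluated on \<open>z\<close>, which
  equals \<open>f\<close> evaluated on the boundary of \<open>z\<close>. Nonzero coefficients in
  \<open>bit\<close> are 1, so the keys determine the chain.\<close>

lemma cochain_sum_over_cycle:
  fixes f :: "'v set \<Rightarrow> bit"
  assumes "boundary2 z = 0" and fin: "\<And>\<sigma>. \<sigma> \<in> Poly_Mapping.keys z \<Longrightarrow> finite \<sigma>"
  shows "(\<Sum>\<sigma>\<in>Poly_Mapping.keys z. \<Sum>v\<in>\<sigma>. f (\<sigma> - {v})) = 0"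
proof -
  define S where "S = (\<Union>\<sigma>\<in>Poly_Mapping.keys z. (\<lambda>v. \<sigma> - {v}) ` \<sigma>)"
  have S: "finite S" unfolding S_def using fin by auto
  have "f (\<sigma> - {v}) = (\<Sum>\<tau>\<in>S. f \<tau> *
      Poly_Mapping.lookup (Poly_Mapping.single (\<sigma> - {v}) (Poly_Mapping.lookup z \<sigma>)) \<tau>)"
    if "\<sigma> \<in> Poly_Mapping.keys z" "v \<in> \<sigma>" for \<sigma> v
  proof -
    have "Poly_Mapping.lookup z \<sigma> = 1" using that(1) by (simp add: in_keys_iff)
    then have "(\<Sum>\<tau>\<in>S. f \<tau> *
        Poly_Mapping.lookup (Poly_Mapping.single (\<sigma> - {v}) (Poly_Mapping.lookup z \<sigma>)) \<tau>) =
      (\<Sum>\<tau>\<in>S. if \<sigma> - {v} = \<tau> then f \<tau> else 0)"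
      by (intro sum.cong) (auto simp: lookup_single when_def)
    also have "\<dots> = f (\<sigma> - {v})" using S that by (auto simp: S_def)
    finally show ?thesis ..
  qed
  then have "(\<Sum>\<sigma>\<in>Poly_Mapping.keys z. \<Sum>v\<in>\<sigma>. f (\<sigma> - {v})) =
      (\<Sum>\<sigma>\<in>Poly_Mapping.keys z. \<Sum>v\<in>\<sigma>. \<Sum>\<tau>\<in>S. f \<tau> *
        Poly_Mapping.lookup (Poly_Mapping.single (\<sigma> - {v}) (Poly_Mapping.lookup z \<sigma>)) \<tau>)"
    by (intro sum.cong refl) 
  also have "\<dots> = (\<Sum>\<tau>\<in>S. f \<tau> * Poly_Mapping.lookup (boundary2 z) \<tau>)"
    unfolding boundary2_def lookup_sum sum_distrib_left
    by (subst sum.swap) (simp add: sum.swap[of _ S])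
  also have "\<dots> = 0" using assms(1) by simp
  finally show ?thesis .
qed

lemma spanning_tree_captures:
  fixes a :: "'v \<Rightarrow> 'b::real_vector"
  assumes tree: "Z2_spanning_tree d X T" and B: "finite B" "independent B" "card B = d"
    and aB: "\<And>\<sigma>. \<sigma> \<in> X \<Longrightarrow> a ` \<sigma> \<subseteq> span B"
    and \<sigma>: "\<sigma> \<in> X" "captures a \<sigma>"
  shows "\<exists>\<tau>\<in>T. captures a \<tau>"
proof (rule ccontr)
  assume none: "\<not> ?thesis"
  have X: "finite X" "simplicial_complex X" "complex_dim X = int d" "T \<subseteq> X"
    and T: "\<And>\<tau>. \<tau> \<in> X \<Longrightarrow> face_dim \<tau> \<le> int d - 1 \<Longrightarrow> \<tau> \<in> T"
    using tree by (auto simp: Z2_spanning_tree_def)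
  have Xsub: "\<rho> \<in> X" if "\<tau> \<in> X" "\<rho> \<subseteq> \<tau>" for \<rho> \<tau>
    using that X(2) by (auto simp: simplicial_complex_def)
  have Xfin: "finite \<tau>" if "\<tau> \<in> X" for \<tau>
    using that X(2) by (auto simp: simplicial_complex_def)
  have card_le: "card \<tau> \<le> Suc d" if "\<tau> \<in> X" for \<tau>
  proof -
    have "face_dim \<tau> \<le> complex_dim X" unfolding complex_dim_def using X(1) that by simp
    then show ?thesis unfolding X(3) face_dim_def by simp
  qed
  \<comment> \<open>Faces of dimension below \<open>d\<close> all belong to \<open>T\<close>, so
    none of them captures. Hence \<open>\<sigma>\<close> has full dimension, and the parity identity
    applies to every simplex of the cycle.\<close>
  have low: "\<not> captures a \<tau>" if "\<tau> \<in> X" "card \<tau> < Suc d" for \<tau>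
    using T[OF that(1)] that(2) none by (auto simp: face_dim_def)
  have card\<sigma>: "card \<sigma> = Suc d"
    using low[OF \<sigma>(1)] \<sigma>(2) card_le[OF \<sigma>(1)] by linarith
  have "facet X \<sigma>"
    unfolding facet_def
  proof (intro conjI \<sigma>(1) ballI impI)
    fix \<tau> assume \<tau>: "\<tau> \<in> X" "\<sigma> \<subseteq> \<tau>"
    then show "\<tau> = \<sigma>"
      using card_seteq[OF Xfin[OF \<tau>(1)] \<tau>(2)] card_le[OF \<tau>(1)] card\<sigma> by simp
  qed
  then obtain z where z: "Poly_Mapping.keys z \<subseteq> {\<tau>\<in>insert \<sigma> T. face_dim \<tau> = int d}"
      "boundary2 z = 0" "\<sigma> \<in> Poly_Mapping.keys z"
    using spanning_tree_fundamental_cycle[OF tree] none \<sigma>(2) by blast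
  have zX: "\<tau> \<in> X" "card \<tau> = Suc d" if "\<tau> \<in> Poly_Mapping.keys z" for \<tau>
    using z(1) that X(4) \<sigma>(1) by (auto simp: face_dim_def)
  have "finite (\<Union>X)" using X(1) Xfin by blast
  from exists_generic_direction[OF this B(1,2), of a]
  obtain q where q: "q \<in> span B"
    "\<And>p. \<forall>\<^sub>F t in at_right (0::real). \<forall>\<rho>\<subseteq>\<Union>X. card \<rho> < card B \<longrightarrow> p + t *\<^sub>R q \<notin> span (a ` \<rho>)"
    by blast
  \<comment> \<open>Any generic point will do here, unlike in the colourful argument, so the base
    point is 0.\<close>
  obtain t :: real where t: "\<forall>\<rho>\<subseteq>\<Union>X. card \<rho> < card B \<longrightarrow> 0 + t *\<^sub>R q \<notin> span (a ` \<rho>)"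
    using eventually_happens[OF q(2)[of 0]] trivial_limit_at_right_real by blast
  define w where "w = t *\<^sub>R q"
  have wB: "w \<in> span B" unfolding w_def using q(1) by (rule span_scale)
  have facets: "(\<Sum>v\<in>\<tau>. of_bool (in_cone a (\<tau> - {v}) w) :: bit) = of_bool (captures a \<tau>)"
    if \<tau>: "\<tau> \<in> Poly_Mapping.keys z" for \<tau>
  proof -
    note \<tau>X = zX(1)[OF \<tau>]
    show ?thesis
    proof (rule sum_cone_facets_eq_captures[OF Xfin[OF \<tau>X] B(1) _ aB[OF \<tau>X] wB])
      show "card \<tau> = Suc (card B)" using zX[OF \<tau>] B(3) by simp
      show "w \<notin> span (a ` \<rho>)" if "\<rho> \<subseteq> \<tau>" "card \<rho> < card B" for \<rho>
        using t that Sup_upper[OF \<tau>X] by (simp add: w_def)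
      show "\<not> captures a \<rho>" if "\<rho> \<subset> \<tau>" for \<rho>
        using low[of \<rho>] Xsub[OF \<tau>X, of \<rho>] that psubset_card_mono[OF Xfin[OF \<tau>X] that]
          card_le[OF \<tau>X] by auto
    qed
  qed
  have "(\<Sum>\<tau>\<in>Poly_Mapping.keys z. of_bool (captures a \<tau>) :: bit) =
      (\<Sum>\<tau>\<in>Poly_Mapping.keys z. \<Sum>v\<in>\<tau>. of_bool (in_cone a (\<tau> - {v}) w))"
    by (rule sum.cong[OF refl]) (rule facets[symmetric])
  also have "\<dots> = 0"
    using cochain_sum_over_cycle[OF z(2), of "\<lambda>\<tau>. of_bool (in_cone a \<tau> w)"] Xfin zX(1) by blast
  \<comment> \<open>Apart from \<open>\<sigma>\<close> the cycle runs inside \<open>T\<close>, so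
    only \<open>\<sigma>\<close> contributes and the even count would be 1.\<close>
  also have "(\<Sum>\<tau>\<in>Poly_Mapping.keys z. of_bool (captures a \<tau>) :: bit) =
      (\<Sum>\<tau>\<in>{\<sigma>}. of_bool (captures a \<tau>))"
    by (rule sum.mono_neutral_right) (use z none in auto)
  finally show False using \<sigma>(2) by simp
qed

section \<open>From images of open simplices to capturing faces and back\<close>

theorem theorem13:
  fixes d :: nat
    and V :: "nat \<Rightarrow> 'v set"
    and T :: "'v set set"
    and A :: "('v \<Rightarrow>\<^sub>0 real) \<Rightarrow> (nat \<Rightarrow>\<^sub>0 real)"
  assumes "\<And>i. i \<in> {1..d+1} \<Longrightarrow> finite (V i)"
    and "\<And>i. i \<in> {1..d+1} \<Longrightarrow> V i \<noteq> {}"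
    and "disjoint_family_on V {1..d+1}"
    and "Z2_spanning_tree d (discrete_join {1..d+1} V) T"
    and "A \<in> realization (full_simplex (\<Union>i\<in>{1..d+1}. V i)) \<rightarrow> real_space d"
    and "affine_map_on (full_simplex (\<Union>i\<in>{1..d+1}. V i)) A"
    and "\<And>i j. 1 \<le> i \<Longrightarrow> i < j \<Longrightarrow> j \<le> d + 1 \<Longrightarrow> 0 \<in> face_image A (V i \<union> V j)"
  shows "\<exists>\<sigma>\<in>T. 0 \<in> face_image A \<sigma>"
proof -
  let ?I = "{1..d+1}" and ?a = "\<lambda>v. A (basis_vec v)"
  let ?U = "\<Union>i\<in>?I. V i" and ?X = "discrete_join ?I V"
  let ?B = "basis_vec ` {..<d} :: (nat \<Rightarrow>\<^sub>0 real) set"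
  have aU: "?a v \<in> real_space d" if "v \<in> ?U" for v
  proof -
    have "basis_vec v \<in> open_simplex {v}"
      using open_simplexI[of "{v}" "\<lambda>_. 1"] by simp
    moreover have "{v} \<in> full_simplex ?U" using that by (simp add: full_simplex_def)
    ultimately have "basis_vec v \<in> realization (full_simplex ?U)"
      unfolding realization_def by (rule UN_I[rotated])
    with assms(5) show ?thesis by (rule funcset_mem)
  qed
  have pairs: "captures ?a (V i \<union> V j)" if "i \<in> ?I" "j \<in> ?I" "i \<noteq> j" for i j
  proof (rule captures_if_face_image[OF assms(6)])
    show "V i \<union> V j \<in> full_simplex ?U" using that(1,2) by (auto simp: full_simplex_def)
    show "finite (V i \<union> V j)" using assms(1) that(1,2) by blast
    show "0 \<in> face_image A (V i \<union> V j)"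
      using assms(7)[of i j] assms(7)[of j i] that by (cases "i < j") (auto simp: Un_commute)
  qed
  have "\<exists>\<sigma>\<in>?X. captures ?a \<sigma>"
  proof (rule colourful_caratheodory[where d = d])
    show "?a v \<in> real_space d" if "i \<in> ?I" "v \<in> V i" for i v
      using aU[of v] that by blast
  qed (use assms(1-3) pairs in auto)
  then obtain \<sigma> where \<sigma>: "\<sigma> \<in> ?X" "captures ?a \<sigma>" by blast
  have XU: "\<rho> \<subseteq> ?U" if "\<rho> \<in> ?X" for \<rho> using that by (simp add: discrete_join_def)
  have "\<exists>\<tau>\<in>T. captures ?a \<tau>"
  proof (rule spanning_tree_captures[OF assms(4) _ _ _ _ \<sigma>])
    show "finite ?B" "independent ?B" "card ?B = d"
      using independent_basis_vec[of "{..<d}"] by (simp_all add: card_image[OF inj_basis_vec])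
    show "?a ` \<rho> \<subseteq> span ?B" if "\<rho> \<in> ?X" for \<rho>
      using XU[OF that] aU coord_space_subset_span[of "{..<d}"] by blast
  qed
  then obtain \<tau> where \<tau>: "\<tau> \<in> T" "captures ?a \<tau>" by blast
  have "simplicial_complex T" "T \<subseteq> ?X" using assms(4) by (auto simp: Z2_spanning_tree_def)
  then have "\<tau> \<subseteq> ?U" "finite \<tau>" and down: "\<And>\<rho>. \<rho> \<subseteq> \<tau> \<Longrightarrow> \<rho> \<in> T"
    using \<tau>(1) XU by (auto simp: simplicial_complex_def)
  \<comment> \<open>A capturing face of \<open>T\<close> may reach 0 only on its boundary; the
    smaller face whose open simplex reaches 0 still belongs to \<open>T\<close>, which is closed
    under subsets.\<close>
  then obtain \<rho> where "\<rho> \<subseteq> \<tau>" "0 \<in> face_image A \<rho>"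
    using face_image_if_captures[OF assms(6) _ _ \<tau>(2)] by blast
  then show ?thesis using down by blast
qed

end
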